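(* Let $\varphi$ be a Banach bundle map from the Banach bundle $\xi_1=(\mathcal{E}_1,p_1,T)$ to the Banach bundle $\xi_2=(\mathcal{E}_2,p_2,T)$ which is an open map and satisfies $\varphi(\mathcal{E}_1)=\mathcal{E}_2$. Suppose that $\mathcal{E}_2$ is paracompact. Then there exists a continuous map $\psi:\mathcal{E}_2\to\mathcal{E}_1$ such that $\varphi(\psi(y))=y$ for every $y\in\mathcal{E}_2$.
   Context: $\mathbb{K}$ is the real or the complex field. A Banach bundle $\xi=(\mathcal{E},p,T)$ consists of a Hausdorff space $T$ (base space), a topological space $\mathcal{E}$ (bundle space, not assumed Hausdorff), and a continuous open surjection $p:\mathcal{E}\to T$ such that each fiber $\mathcal{E}(t)=p^{-1}(t)$ is a Banach space over $\mathbb{K}$ with origin $0_t$, and: addition $\{(x,y)\in\mathcal{E}\times\mathcal{E}: p(x)=p(y)\}\to\mathcal{E}$ and scalar multiplication $\mathbb{K}\times\mathcal{E}\to\mathcal{E}$ are continuous; $x\mapsto\|x\|$ is upper semi-continuous on $\mathcal{E}$; and if $(x_\iota)$ is a net in $\mathcal{E}$ with $p(x_\iota)\to t$ and $\|x_\iota\|\to 0$, then $x_\iota\to 0_t$. Paracompact spaces are assumed Hausdorff. A Banach bundle map from $\xi_1$ to $\xi_2$ is a continuous map $\varphi:\mathcal{E}_1\to\mathcal{E}_2$ with $\varphi(p_1^{-1}(t))\subset p_2^{-1}(t)$ for every $t\in T$ whose restriction to each fiber is linear. *)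

theory Defs
  imports "HOL-Analysis.Analysis"
begin

text \<open>The scalar field is a set \<open>K\<close> of complex numbers, either \<open>\<real>\<close> or \<open>UNIV\<close>, so
  that the real and the complex case are covered by one definition.  The operations are
  only relevant on the carrier \<open>V\<close> and for scalars in \<open>K\<close>.\<close>

locale banach_space_on =
  fixes K :: "complex set"
    and V :: "'a set"
    and add :: "'a \<Rightarrow> 'a \<Rightarrow> 'a"
    and scale :: "complex \<Rightarrow> 'a \<Rightarrow> 'a"
    and zero :: 'a
    and nrm :: "'a \<Rightarrow> real"
  assumes add_closed: "\<lbrakk>x \<in> V; y \<in> V\<rbrakk> \<Longrightarrow> add x y \<in> V"
    and scale_closed: "\<lbrakk>c \<in> K; x \<in> V\<rbrakk> \<Longrightarrow> scale c x \<in> V"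
    and zero_closed: "zero \<in> V"
    and add_assoc: "\<lbrakk>x \<in> V; y \<in> V; z \<in> V\<rbrakk> \<Longrightarrow> add (add x y) z = add x (add y z)"
    and add_commute: "\<lbrakk>x \<in> V; y \<in> V\<rbrakk> \<Longrightarrow> add x y = add y x"
    and add_zero: "x \<in> V \<Longrightarrow> add x zero = x"
    and add_inverse: "x \<in> V \<Longrightarrow> \<exists>y\<in>V. add x y = zero"
    and scale_add_right: "\<lbrakk>c \<in> K; x \<in> V; y \<in> V\<rbrakk> \<Longrightarrow> scale c (add x y) = add (scale c x) (scale c y)"
    and scale_add_left: "\<lbrakk>c \<in> K; d \<in> K; x \<in> V\<rbrakk> \<Longrightarrow> scale (c + d) x = add (scale c x) (scale d x)"
    and scale_scale: "\<lbrakk>c \<in> K; d \<in> K; x \<in> V\<rbrakk> \<Longrightarrow> scale c (scale d x) = scale (c * d) x"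
    and scale_one: "x \<in> V \<Longrightarrow> scale 1 x = x"
    and nrm_nonneg: "x \<in> V \<Longrightarrow> 0 \<le> nrm x"
    and nrm_eq_0_iff: "x \<in> V \<Longrightarrow> nrm x = 0 \<longleftrightarrow> x = zero"
    and nrm_triangle: "\<lbrakk>x \<in> V; y \<in> V\<rbrakk> \<Longrightarrow> nrm (add x y) \<le> nrm x + nrm y"
    and nrm_scale: "\<lbrakk>c \<in> K; x \<in> V\<rbrakk> \<Longrightarrow> nrm (scale c x) = cmod c * nrm x"
    and complete: "\<And>s :: nat \<Rightarrow> 'a.
        \<lbrakk>\<And>n. s n \<in> V;
         \<And>e. e > 0 \<Longrightarrow> \<exists>N. \<forall>m\<ge>N. \<forall>n\<ge>N. nrm (add (s m) (scale (- 1) (s n))) < e\<rbrakk>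
        \<Longrightarrow> \<exists>l\<in>V. (\<lambda>n. nrm (add (s n) (scale (- 1) l))) \<longlonglongrightarrow> 0"

record ('e, 't) bundle_data =
  bundle_space :: "'e topology"
  base_space :: "'t topology"
  bundle_proj :: "'e \<Rightarrow> 't"
  fib_add :: "'e \<Rightarrow> 'e \<Rightarrow> 'e"
  fib_scale :: "complex \<Rightarrow> 'e \<Rightarrow> 'e"
  fib_zero :: "'t \<Rightarrow> 'e"
  fib_norm :: "'e \<Rightarrow> real"

definition fiber :: "('e, 't) bundle_data \<Rightarrow> 't \<Rightarrow> 'e set" where
  "fiber \<xi> t = {x \<in> topspace (bundle_space \<xi>). bundle_proj \<xi> x = t}"

text \<open>In the axiom \<open>tendsto_zero\<close> nets in the bundle space are represented by filters: a net
  \<open>(x\<^sub>\<iota>)\<close> gives the filter of the sets that eventually contain \<open>x\<^sub>\<iota>\<close>, and every filter arises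
  in this way from a net.  The version for an arbitrary index type is \<open>tendsto_zero_net\<close>.\<close>

locale banach_bundle =
  fixes K :: "complex set" and \<xi> :: "('e, 't) bundle_data"
  assumes scalars: "K = \<real> \<or> K = UNIV"
    and Hausdorff_base: "Hausdorff_space (base_space \<xi>)"
    and continuous_proj: "continuous_map (bundle_space \<xi>) (base_space \<xi>) (bundle_proj \<xi>)"
    and open_proj: "open_map (bundle_space \<xi>) (base_space \<xi>) (bundle_proj \<xi>)"
    and surj_proj: "bundle_proj \<xi> ` topspace (bundle_space \<xi>) = topspace (base_space \<xi>)"
    and banach_fiber: "t \<in> topspace (base_space \<xi>) \<Longrightarrow>
          banach_space_on K (fiber \<xi> t) (fib_add \<xi>) (fib_scale \<xi>) (fib_zero \<xi> t) (fib_norm \<xi>)"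
    and continuous_add:
          "continuous_map
             (subtopology (prod_topology (bundle_space \<xi>) (bundle_space \<xi>))
                {(x, y). bundle_proj \<xi> x = bundle_proj \<xi> y})
             (bundle_space \<xi>) (\<lambda>(x, y). fib_add \<xi> x y)"
    and continuous_scale:
          "continuous_map (prod_topology (top_of_set K) (bundle_space \<xi>)) (bundle_space \<xi>)
             (\<lambda>(c, x). fib_scale \<xi> c x)"
    and upper_semicontinuous_norm:
          "openin (bundle_space \<xi>) {x \<in> topspace (bundle_space \<xi>). fib_norm \<xi> x < a}"
    and tendsto_zero:
          "\<lbrakk>eventually (\<lambda>x. x \<in> topspace (bundle_space \<xi>)) F;
            limitin (base_space \<xi>) (bundle_proj \<xi>) t F;
            (fib_norm \<xi> \<longlongrightarrow> 0) F\<rbrakk>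
           \<Longrightarrow> limitin (bundle_space \<xi>) (\<lambda>x. x) (fib_zero \<xi> t) F"

lemma (in banach_bundle) tendsto_zero_net:
  assumes "eventually (\<lambda>i. x i \<in> topspace (bundle_space \<xi>)) G"
    and "limitin (base_space \<xi>) (\<lambda>i. bundle_proj \<xi> (x i)) t G"
    and "((\<lambda>i. fib_norm \<xi> (x i)) \<longlongrightarrow> 0) G"
  shows "limitin (bundle_space \<xi>) x (fib_zero \<xi> t) G"
  using tendsto_zero[of "filtermap x G" t] assms
  by (simp add: limitin_def eventually_filtermap filterlim_filtermap)

definition banach_bundle_map ::
    "complex set \<Rightarrow> ('e1, 't) bundle_data \<Rightarrow> ('e2, 't) bundle_data \<Rightarrow> ('e1 \<Rightarrow> 'e2) \<Rightarrow> bool" where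
  "banach_bundle_map K \<xi>1 \<xi>2 \<phi> \<longleftrightarrow>
     base_space \<xi>1 = base_space \<xi>2 \<and>
     continuous_map (bundle_space \<xi>1) (bundle_space \<xi>2) \<phi> \<and>
     (\<forall>t\<in>topspace (base_space \<xi>1).
        \<phi> ` fiber \<xi>1 t \<subseteq> fiber \<xi>2 t \<and>
        (\<forall>x\<in>fiber \<xi>1 t. \<forall>y\<in>fiber \<xi>1 t. \<phi> (fib_add \<xi>1 x y) = fib_add \<xi>2 (\<phi> x) (\<phi> y)) \<and>
        (\<forall>c\<in>K. \<forall>x\<in>fiber \<xi>1 t. \<phi> (fib_scale \<xi>1 c x) = fib_scale \<xi>2 c (\<phi> x)))"

definition paracompact_space :: "'a topology \<Rightarrow> bool" where
  "paracompact_space X \<longleftrightarrow>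
     Hausdorff_space X \<and>
     (\<forall>\<U>. (\<forall>U\<in>\<U>. openin X U) \<and> \<Union>\<U> = topspace X \<longrightarrow>
        (\<exists>\<V>. (\<forall>V\<in>\<V>. openin X V) \<and> \<Union>\<V> = topspace X \<and>
             (\<forall>V\<in>\<V>. \<exists>U\<in>\<U>. V \<subseteq> U) \<and> locally_finite_in X \<V>))"

end

theory Submission
  imports "HOL-Algebra.FiniteProduct" Defs
begin

text \<open>The proof is a selection argument that never needs continuous local sections. A lift
  \<open>f\<close> is \<open>e\<close>-continuous at \<open>y\<^sub>0\<close> if for every neighbourhood \<open>W\<close> of \<open>f y\<^sub>0\<close> and every \<open>y\<close> near
  \<open>y\<^sub>0\<close> some \<open>w \<in> W\<close> with \<open>\<phi> w = \<phi> (f y)\<close> has distance at most \<open>e\<close> from \<open>f y\<close>. Every point of the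
  bundle has neighbourhoods of small fibrewise diameter, and, since \<open>\<phi>\<close> is open, an arbitrary
  section of \<open>\<phi>\<close> with values in such a neighbourhood is \<open>e\<close>-continuous; gluing such sections with a
  partition of unity gives a global \<open>e\<close>-continuous section \<open>f\<close>. Such an \<open>f\<close> has, locally in \<open>y\<close>,
  preimages of \<open>y\<close> within \<open>e\<close> of \<open>f y\<close> that all lie in one set of fibrewise diameter less than
  \<open>e/2\<close>; gluing these gives an \<open>e/2\<close>-continuous section within \<open>e\<close> of \<open>f\<close>. The sequence obtained
  by iteration converges uniformly, and its limit is continuous because it can be approximated
  uniformly by \<open>e\<close>-continuous sections for every \<open>e\<close>.\<close>

section \<open>Partitions of unity on paracompact spaces\<close>

lemma paracompact_space_refine:
  assumes "paracompact_space X" "\<And>U. U \<in> \<U> \<Longrightarrow> openin X U" "topspace X \<subseteq> \<Union>\<U>"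
  obtains \<V> where "\<And>V. V \<in> \<V> \<Longrightarrow> openin X V" "\<Union>\<V> = topspace X"
    "\<And>V. V \<in> \<V> \<Longrightarrow> \<exists>U\<in>\<U>. V \<subseteq> U" "locally_finite_in X \<V>"
proof -
  have "(\<forall>U\<in>\<U>. openin X U) \<and> \<Union>\<U> = topspace X"
    using assms(2,3) openin_subset by blast
  then have "\<exists>\<V>. (\<forall>V\<in>\<V>. openin X V) \<and> \<Union>\<V> = topspace X \<and>
             (\<forall>V\<in>\<V>. \<exists>U\<in>\<U>. V \<subseteq> U) \<and> locally_finite_in X \<V>"
    using conjunct2[OF assms(1)[unfolded paracompact_space_def], THEN spec[where x=\<U>]]
    by (rule rev_mp)
  then obtain \<V> where "(\<forall>V\<in>\<V>. openin X V) \<and> \<Union>\<V> = topspace X \<and>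
             (\<forall>V\<in>\<V>. \<exists>U\<in>\<U>. V \<subseteq> U) \<and> locally_finite_in X \<V>" ..
  then show ?thesis
    by (intro that[of \<V>]) auto
qed

text \<open>Separation of single points from \<open>S\<close> passes to the closed set
  \<open>C\<close>: the closures of the separating neighbourhoods miss \<open>S\<close>, and in a
  locally finite refinement the union of such closures is still closed, so its complement is an open
  set around \<open>S\<close>. A singleton \<open>S\<close> gives regularity from the Hausdorff
  property, and a closed \<open>S\<close> gives normality from regularity.\<close>

lemma paracompact_space_separation:
  assumes X: "paracompact_space X" and C: "closedin X C"
    and sep: "\<And>c. c \<in> C \<Longrightarrow> \<exists>U V. openin X U \<and> openin X V \<and> c \<in> U \<and> S \<subseteq> V \<and> disjnt U V"
    and S: "S \<subseteq> topspace X"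
  obtains U V where "openin X U" "openin X V" "C \<subseteq> U" "S \<subseteq> V" "disjnt U V"
proof -
  define \<U> where "\<U> = insert (topspace X - C)
     {U. openin X U \<and> (\<exists>V. openin X V \<and> S \<subseteq> V \<and> disjnt U V)}"
  have cov: "topspace X \<subseteq> \<Union>\<U>"
  proof
    fix x assume "x \<in> topspace X"
    then show "x \<in> \<Union>\<U>"
      using sep[of x] by (cases "x \<in> C") (auto simp: \<U>_def)
  qed
  have op: "openin X U" if "U \<in> \<U>" for U
    using that C by (auto simp: \<U>_def closedin_def)
  obtain \<V> where \<V>: "\<And>V. V \<in> \<V> \<Longrightarrow> openin X V" "\<Union>\<V> = topspace X"
    "\<And>V. V \<in> \<V> \<Longrightarrow> \<exists>U\<in>\<U>. V \<subseteq> U" "locally_finite_in X \<V>"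
    using paracompact_space_refine[OF X op cov] by metis
  \<comment> \<open>A member that meets \<open>C\<close> is not contained in
    \<open>topspace X - C\<close>, so it refines one of the neighbourhoods separated from
    \<open>S\<close>; these members still cover \<open>C\<close>.\<close>
  define \<W> where "\<W> = {V \<in> \<V>. V \<inter> C \<noteq> {}}"
  have lf: "locally_finite_in X \<W>"
    using \<V>(4) by (rule locally_finite_in_subset) (auto simp: \<W>_def)
  have cl: "X closure_of V \<inter> S = {}" if V: "V \<in> \<W>" for V
  proof -
    obtain U where "U \<in> \<U>" "V \<subseteq> U"
      using V \<V>(3) unfolding \<W>_def by blast
    moreover have "U \<noteq> topspace X - C"
      using V \<open>V \<subseteq> U\<close> unfolding \<W>_def by blast
    ultimately obtain V' where "openin X V'" "S \<subseteq> V'" "disjnt V V'"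
      unfolding \<U>_def disjnt_def by auto
    then have "V' \<inter> X closure_of V = {}"
      by (subst openin_Int_closure_of_eq_empty) (auto simp: disjnt_def)
    then show ?thesis
      using \<open>S \<subseteq> V'\<close> by blast
  qed
  define D where "D = \<Union>((\<lambda>V. X closure_of V) ` \<W>)"
  have "closedin X D"
    unfolding D_def
    by (rule closedin_locally_finite_Union[OF _ locally_finite_in_closure[OF lf]]) auto
  have "S \<inter> D = {}"
    using cl by (auto simp: D_def)
  have "\<Union>\<W> \<subseteq> D"
    using closure_of_subset[OF openin_subset[OF \<V>(1)]] by (auto simp: \<W>_def D_def)
  show ?thesis
  proof (rule that)
    show "openin X (\<Union>\<W>)"
      using \<V>(1) by (auto simp: \<W>_def)
    show "openin X (topspace X - D)"
      using \<open>closedin X D\<close> by (simp add: closedin_def)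
    show "C \<subseteq> \<Union>\<W>"
    proof
      fix c assume c: "c \<in> C"
      then have "c \<in> \<Union>\<V>"
        using \<V>(2) closedin_subset[OF C] by auto
      then show "c \<in> \<Union>\<W>"
        using c by (auto simp: \<W>_def)
    qed
    show "S \<subseteq> topspace X - D"
      using \<open>S \<inter> D = {}\<close> S by blast
    show "disjnt (\<Union>\<W>) (topspace X - D)"
      using \<open>\<Union>\<W> \<subseteq> D\<close> by (auto simp: disjnt_def)
  qed
qed

lemma paracompact_imp_regular_space:
  assumes X: "paracompact_space X"
  shows "regular_space X"
  unfolding regular_space_def
proof (intro allI impI)
  fix C a assume a: "closedin X C \<and> a \<in> topspace X - C"
  have "\<exists>U V. openin X U \<and> openin X V \<and> c \<in> U \<and> {a} \<subseteq> V \<and> disjnt U V" if "c \<in> C" for c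
  proof -
    have "Hausdorff_space X"
      using X by (simp add: paracompact_space_def)
    moreover have "c \<in> topspace X" "a \<in> topspace X" "c \<noteq> a"
      using a that closedin_subset[of X C] by auto
    ultimately show ?thesis
      by (simp add: Hausdorff_space_def)
  qed
  then obtain U V where "openin X U" "openin X V" "C \<subseteq> U" "{a} \<subseteq> V" "disjnt U V"
    using paracompact_space_separation[OF X, of C "{a}"] a by auto
  then show "\<exists>U V. openin X U \<and> openin X V \<and> a \<in> U \<and> C \<subseteq> V \<and> disjnt U V"
    by (intro exI[of _ V] exI[of _ U]) (auto simp: disjnt_sym)
qed

lemma paracompact_imp_normal_space:
  assumes X: "paracompact_space X"
  shows "normal_space X"
  unfolding normal_space_def
proof (intro allI impI)
  fix S T assume ST: "closedin X S \<and> closedin X T \<and> disjnt S T"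
  have "\<exists>U V. openin X U \<and> openin X V \<and> c \<in> U \<and> T \<subseteq> V \<and> disjnt U V" if "c \<in> S" for c
  proof -
    have "c \<in> topspace X - T"
      using ST that closedin_subset[of X S] by (auto simp: disjnt_iff)
    then show ?thesis
      using ST paracompact_imp_regular_space[OF X] by (simp add: regular_space_def)
  qed
  moreover have "closedin X S" "T \<subseteq> topspace X"
    using ST closedin_subset[of X T] by auto
  ultimately obtain U V where "openin X U" "openin X V" "S \<subseteq> U" "T \<subseteq> V" "disjnt U V"
    using paracompact_space_separation[OF X] by metis
  then show "\<exists>U V. openin X U \<and> openin X V \<and> S \<subseteq> U \<and> T \<subseteq> V \<and> disjnt U V"
    by blast
qed

text \<open>By regularity the open sets whose closure lies in a member of \<open>\<U>\<close> cover
  the space; a locally finite refinement of this finer cover inherits the condition on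
  closures.\<close>

lemma paracompact_space_refine_closure:
  assumes X: "paracompact_space X" and \<U>: "\<And>U. U \<in> \<U> \<Longrightarrow> openin X U" "topspace X \<subseteq> \<Union>\<U>"
  obtains \<V> where "\<And>V. V \<in> \<V> \<Longrightarrow> openin X V" "\<Union>\<V> = topspace X"
    "\<And>V. V \<in> \<V> \<Longrightarrow> \<exists>U\<in>\<U>. X closure_of V \<subseteq> U" "locally_finite_in X \<V>"
proof -
  define \<W> where "\<W> = {W. openin X W \<and> (\<exists>U\<in>\<U>. X closure_of W \<subseteq> U)}"
  have "x \<in> \<Union>\<W>" if x: "x \<in> topspace X" for x
  proof -
    obtain U where U: "U \<in> \<U>" "x \<in> U"
      using x \<U>(2) by blast
    have "closedin X (topspace X - U) \<and> x \<in> topspace X - (topspace X - U)"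
      using U \<U>(1) x by blast
    then have "\<exists>A B. openin X A \<and> openin X B \<and> x \<in> A \<and> topspace X - U \<subseteq> B \<and> disjnt A B"
      using paracompact_imp_regular_space[OF X] by (simp add: regular_space_def)
    then obtain A B where AB: "openin X A" "openin X B" "x \<in> A" "topspace X - U \<subseteq> B" "disjnt A B"
      by blast
    have "B \<inter> X closure_of A = {}"
      using AB by (subst openin_Int_closure_of_eq_empty) (auto simp: disjnt_def)
    then have "X closure_of A \<subseteq> U"
      using AB(4) closure_of_subset_topspace[of X A] by blast
    then have "A \<in> \<W>"
      using AB(1) U(1) by (auto simp: \<W>_def)
    then show ?thesis
      using AB(3) by blast
  qed
  then have cov: "topspace X \<subseteq> \<Union>\<W>"
    by blast
  have op: "openin X W" if "W \<in> \<W>" for W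
    using that by (simp add: \<W>_def)
  obtain \<V> where \<V>: "\<And>V. V \<in> \<V> \<Longrightarrow> openin X V" "\<Union>\<V> = topspace X"
    "\<And>V. V \<in> \<V> \<Longrightarrow> \<exists>U\<in>\<W>. V \<subseteq> U" "locally_finite_in X \<V>"
    using paracompact_space_refine[OF X op cov] by metis
  show ?thesis
  proof (rule that[OF \<V>(1,2) _ \<V>(4)])
    fix V assume "V \<in> \<V>"
    then obtain W where "W \<in> \<W>" "V \<subseteq> W"
      using \<V>(3) by blast
    then obtain U where "U \<in> \<U>" "X closure_of W \<subseteq> U"
      by (auto simp: \<W>_def)
    then show "\<exists>U\<in>\<U>. X closure_of V \<subseteq> U"
      using closure_of_mono[OF \<open>V \<subseteq> W\<close>, of X] by blast
  qed
qed

lemma locally_finite_in_nhd: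
  assumes "locally_finite_in X \<V>" "x \<in> topspace X"
  obtains N where "openin X N" "x \<in> N" "finite {V \<in> \<V>. V \<inter> N \<noteq> {}}"
  using assms unfolding locally_finite_in_def by auto

lemma locally_finite_in_at:
  assumes "locally_finite_in X \<V>" "x \<in> topspace X"
  shows "finite {V \<in> \<V>. x \<in> V}"
proof -
  obtain N where "openin X N" "x \<in> N" "finite {V \<in> \<V>. V \<inter> N \<noteq> {}}"
    using locally_finite_in_nhd assms by metis
  then show ?thesis
    by (elim finite_subset[rotated]) auto
qed

text \<open>Shrinking the cover twice leaves closed sets \<open>C V\<close> inside the members
  \<open>V\<close> that still cover the space. Urysohn functions that are 1 on \<open>C V\<close>
  and 0 off \<open>V\<close> have a positive, locally finite sum, by which they are divided. The
  closures appear in the conclusion because the gluing argument needs every point outside the chosen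
  cover member to have a neighbourhood that misses \<open>V\<close>.\<close>

theorem paracompact_partition_of_unity:
  assumes X: "paracompact_space X" and \<U>: "\<And>U. U \<in> \<U> \<Longrightarrow> openin X U" "topspace X \<subseteq> \<Union>\<U>"
  obtains \<V> and h :: "'a set \<Rightarrow> 'a \<Rightarrow> real"
  where "locally_finite_in X \<V>" "\<forall>V\<in>\<V>. openin X V \<and> (\<exists>U\<in>\<U>. X closure_of V \<subseteq> U)"
    "\<forall>V\<in>\<V>. continuous_map X euclideanreal (h V)"
    "\<forall>V\<in>\<V>. \<forall>x\<in>topspace X. 0 \<le> h V x \<and> (x \<notin> V \<longrightarrow> h V x = 0)"
    "\<forall>x\<in>topspace X. (\<Sum>V | V \<in> \<V> \<and> x \<in> V. h V x) = 1"
proof -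
  obtain \<V> where \<V>: "\<And>V. V \<in> \<V> \<Longrightarrow> openin X V" "\<Union>\<V> = topspace X"
    "\<And>V. V \<in> \<V> \<Longrightarrow> \<exists>U\<in>\<U>. X closure_of V \<subseteq> U" "locally_finite_in X \<V>"
    using paracompact_space_refine_closure[OF X \<U>] by metis
  have \<V>_cov: "topspace X \<subseteq> \<Union>\<V>"
    using \<V>(2) by simp
  obtain \<W> where \<W>: "\<And>V. V \<in> \<W> \<Longrightarrow> openin X V" "\<Union>\<W> = topspace X"
    "\<And>W. W \<in> \<W> \<Longrightarrow> \<exists>V\<in>\<V>. X closure_of W \<subseteq> V" "locally_finite_in X \<W>"
    using paracompact_space_refine_closure[OF X \<V>(1) \<V>_cov] by metis
  \<comment> \<open>Possibly infinitely many closures are united here; local finiteness of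
    \<open>\<W>\<close> keeps the union closed.\<close>
  define C where "C V = \<Union>((\<lambda>W. X closure_of W) ` {W \<in> \<W>. X closure_of W \<subseteq> V})" for V
  have clC: "closedin X (C V)" for V
  proof -
    have "locally_finite_in X {W \<in> \<W>. X closure_of W \<subseteq> V}"
      using \<W>(4) by (rule locally_finite_in_subset) auto
    then show ?thesis
      unfolding C_def by (intro closedin_locally_finite_Union locally_finite_in_closure) auto
  qed
  have "\<exists>g. continuous_map X euclideanreal g \<and> (\<forall>x\<in>topspace X. 0 \<le> g x) \<and>
          (\<forall>x\<in>C V. g x = 1) \<and> (\<forall>x\<in>topspace X. x \<notin> V \<longrightarrow> g x = 0)" if V: "V \<in> \<V>" for V
  proof -
    have "closedin X (topspace X - V)" "disjnt (topspace X - V) (C V)"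
      using \<V>(1)[OF V] by (auto simp: C_def disjnt_def)
    then obtain g :: "'a \<Rightarrow> real" where g: "continuous_map X (top_of_set {0..1}) g"
        "g ` (topspace X - V) \<subseteq> {0}" "g ` C V \<subseteq> {1}"
      using Urysohn_lemma[OF paracompact_imp_normal_space[OF X] _ clC, of "topspace X - V" V 0 1]
      by auto
    show ?thesis
      using g by (intro exI[of _ g]) (auto simp: continuous_map_in_subtopology image_subset_iff)
  qed
  then have "\<forall>V\<in>\<V>. \<exists>g. continuous_map X euclideanreal g \<and> (\<forall>x\<in>topspace X. 0 \<le> g x) \<and>
          (\<forall>x\<in>C V. g x = 1) \<and> (\<forall>x\<in>topspace X. x \<notin> V \<longrightarrow> g x = 0)"
    by blast
  from bchoice[OF this] obtain g where g: "\<And>V. V \<in> \<V> \<Longrightarrow> continuous_map X euclideanreal (g V)"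
      "\<And>V x. V \<in> \<V> \<Longrightarrow> x \<in> topspace X \<Longrightarrow> 0 \<le> g V x"
      "\<And>V x. V \<in> \<V> \<Longrightarrow> x \<in> C V \<Longrightarrow> g V x = 1"
      "\<And>V x. V \<in> \<V> \<Longrightarrow> x \<in> topspace X \<Longrightarrow> x \<notin> V \<Longrightarrow> g V x = 0"
    by blast
  define G where "G x = (\<Sum>V | V \<in> \<V> \<and> x \<in> V. g V x)" for x
  note fin = locally_finite_in_at[OF \<V>(4)]
  have Gpos: "0 < G x" if x: "x \<in> topspace X" for x
  proof -
    obtain W where W: "W \<in> \<W>" "x \<in> W"
      using x \<W>(2) by blast
    then obtain V where V: "V \<in> \<V>" "X closure_of W \<subseteq> V"
      using \<W>(3) by blast
    have "x \<in> X closure_of W"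
      using W(2) closure_of_subset[OF openin_subset[OF \<W>(1)[OF W(1)]]] by (rule subsetD[rotated])
    then have "x \<in> V" "x \<in> C V"
      using V W by (auto simp: C_def)
    have "0 < g V x"
      using g(3)[OF V(1) \<open>x \<in> C V\<close>] by simp
    also have "g V x \<le> G x"
      unfolding G_def using V \<open>x \<in> V\<close> x by (intro member_le_sum g(2) fin) auto
    finally show ?thesis .
  qed
  have Gcont: "continuous_map X euclideanreal G"
    unfolding continuous_map_atin limitin_canonical_iff
  proof
    fix x assume x: "x \<in> topspace X"
    obtain N where N: "openin X N" "x \<in> N" "finite {V \<in> \<V>. V \<inter> N \<noteq> {}}"
      using locally_finite_in_nhd[OF \<V>(4) x] by metis
    \<comment> \<open>Summands of members not containing \<open>y\<close> vanish at
      \<open>y\<close>, so on \<open>N\<close> the varying index set can be replaced by one finite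
      set, and \<open>G\<close> is locally a finite sum of continuous functions.\<close>
    have eq: "(\<Sum>V | V \<in> \<V> \<and> V \<inter> N \<noteq> {}. g V y) = G y" if "y \<in> N" for y
      unfolding G_def using that N openin_subset[OF N(1)]
      by (intro sum.mono_neutral_right) (auto intro: g(4))
    have "((\<lambda>y. \<Sum>V | V \<in> \<V> \<and> V \<inter> N \<noteq> {}. g V y) \<longlongrightarrow> (\<Sum>V | V \<in> \<V> \<and> V \<inter> N \<noteq> {}. g V x)) (atin X x)"
      using g(1) x by (intro tendsto_sum) (auto simp: continuous_map_atin)
    moreover have "\<forall>\<^sub>F y in atin X x. (\<Sum>V | V \<in> \<V> \<and> V \<inter> N \<noteq> {}. g V y) = G y"
      unfolding eventually_atin using N(1,2) eq by (intro disjI2 exI[of _ N]) auto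
    ultimately have "(G \<longlongrightarrow> (\<Sum>V | V \<in> \<V> \<and> V \<inter> N \<noteq> {}. g V x)) (atin X x)"
      by (rule Lim_transform_eventually)
    then show "(G \<longlongrightarrow> G x) (atin X x)"
      unfolding eq[OF N(2)] .
  qed
  show ?thesis
  proof (rule that[OF \<V>(4)]; intro ballI conjI impI)
    show "continuous_map X euclideanreal (\<lambda>x. g V x / G x)" if "V \<in> \<V>" for V
      using that by (intro continuous_map_real_divide g Gcont) (auto dest: Gpos)
    show "(\<Sum>V | V \<in> \<V> \<and> x \<in> V. g V x / G x) = 1" if "x \<in> topspace X" for x
      using Gpos[OF that] by (simp flip: sum_divide_distrib G_def)
    show "0 \<le> g V x / G x" if "V \<in> \<V>" "x \<in> topspace X" for V x
      using g(2)[OF that] Gpos[OF that(2)] by simp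
    show "g V x / G x = 0" if "V \<in> \<V>" "x \<in> topspace X" "x \<notin> V" for V x
      using g(4)[OF that] by simp
  qed (use \<V>(1,3) in auto)
qed

lemma eventually_nhdsin_topspace: "\<forall>\<^sub>F y in nhdsin X y0. y \<in> topspace X"
  unfolding eventually_nhdsin by auto

lemma eventually_nhdsin_openin: "\<lbrakk>openin X N; y0 \<in> N\<rbrakk> \<Longrightarrow> \<forall>\<^sub>F y in nhdsin X y0. y \<in> N"
  unfolding eventually_nhdsin by auto

section \<open>Fibrewise algebra and neighbourhoods in Banach bundles\<close>

text \<open>Treats the real and the complex case together: the scalars that the argument works with,
  such as -1 and the weights of a partition of unity, are real and hence available in both.\<close>

locale real_banach_space_on = banach_space_on +
  assumes reals: "\<real> \<subseteq> K"
begin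

lemma of_real_in: "of_real r \<in> K"
  using reals Reals_of_real by blast

lemma minus_one_in: "- 1 \<in> K"
  using of_real_in[of "-1"] by simp

lemma one_in: "1 \<in> K"
  using of_real_in[of 1] by simp

lemma zero_in: "0 \<in> K"
  using of_real_in[of 0] by simp

lemmas closed = add_closed scale_closed zero_closed minus_one_in of_real_in

lemma zero_add: "x \<in> V \<Longrightarrow> add zero x = x"
  using add_commute add_zero zero_closed by simp

lemma add_left_commute: "\<lbrakk>x \<in> V; y \<in> V; z \<in> V\<rbrakk> \<Longrightarrow> add x (add y z) = add y (add x z)"
  using add_assoc[of x y z] add_assoc[of y x z] add_commute[of x y] by simp

lemma add_self_eq_zero: 
  assumes "x \<in> V" "add x x = x"
  shows "x = zero"
proof -
  obtain y where y: "y \<in> V" "add x y = zero"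
    using add_inverse assms(1) by blast
  then have "add (add x x) y = x"
    using assms(1) add_zero by (simp add: add_assoc)
  then show ?thesis
    using assms(2) y(2) by simp
qed

lemma scale_zero_left: "x \<in> V \<Longrightarrow> scale 0 x = zero"
  using scale_add_left[of 0 0 x] zero_in by (intro add_self_eq_zero) (auto simp: closed)

lemma add_neg: "x \<in> V \<Longrightarrow> add x (scale (- 1) x) = zero"
  using scale_add_left[of 1 "- 1" x] by (simp add: scale_one one_in minus_one_in scale_zero_left)

text \<open>Subtraction goes through the scalar -1 because the completeness axiom of
  \<open>banach_space_on\<close> has this form.\<close>

definition dif where "dif x y = add x (scale (- 1) y)"

lemma dif_closed: "\<lbrakk>x \<in> V; y \<in> V\<rbrakk> \<Longrightarrow> dif x y \<in> V"
  by (simp add: dif_def closed)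

lemma dif_trans:
  assumes "x \<in> V" "y \<in> V" "z \<in> V"
  shows "dif x z = add (dif x y) (dif y z)"
proof -
  have "add (dif x y) (dif y z) = add (add y (scale (- 1) y)) (add x (scale (- 1) z))"
    using assms by (simp add: dif_def closed add_assoc add_commute add_left_commute)
  then show ?thesis
    using assms by (simp add: add_neg zero_add dif_def closed)
qed

lemma neg_dif:
  assumes "x \<in> V" "y \<in> V"
  shows "scale (- 1) (dif x y) = dif y x"
  using assms
  by (simp add: dif_def scale_add_right scale_scale closed add_commute scale_one)

lemma dif_add:
  assumes "a \<in> V" "b \<in> V" "c \<in> V" "d \<in> V"
  shows "dif (add a b) (add c d) = add (dif a c) (dif b d)"
  using assms by (simp add: dif_def scale_add_right closed add_assoc add_commute add_left_commute)

lemma dif_scale: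
  assumes "c \<in> K" "x \<in> V" "y \<in> V"
  shows "dif (scale c x) (scale c y) = scale c (dif x y)"
  using assms by (simp add: dif_def scale_add_right scale_scale closed)

lemma add_dif_cancel:
  assumes "x \<in> V" "y \<in> V"
  shows "add y (dif x y) = x"
  using assms by (simp add: dif_def closed add_left_commute[of y x] add_neg add_zero)

lemma nrm_zero: "nrm zero = 0"
  using nrm_eq_0_iff zero_closed by simp

lemma nrm_dif_commute: "\<lbrakk>x \<in> V; y \<in> V\<rbrakk> \<Longrightarrow> nrm (dif x y) = nrm (dif y x)"
  using nrm_scale[OF minus_one_in dif_closed, of y x] by (simp add: neg_dif)

lemma nrm_dif_triangle:
  "\<lbrakk>x \<in> V; y \<in> V; z \<in> V\<rbrakk> \<Longrightarrow> nrm (dif x z) \<le> nrm (dif x y) + nrm (dif y z)"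
  by (subst dif_trans[of x y z]) (auto intro: nrm_triangle dif_closed)

lemma nrm_dif_add:
  "\<lbrakk>a \<in> V; b \<in> V; c \<in> V; d \<in> V\<rbrakk>
    \<Longrightarrow> nrm (dif (add a b) (add c d)) \<le> nrm (dif a c) + nrm (dif b d)"
  by (simp add: dif_add nrm_triangle dif_closed)

lemma nrm_dif_scale:
  "\<lbrakk>x \<in> V; y \<in> V\<rbrakk>
    \<Longrightarrow> nrm (dif (scale (of_real r) x) (scale (of_real r) y)) = \<bar>r\<bar> * nrm (dif x y)"
  by (simp add: dif_scale of_real_in nrm_scale dif_closed)

text \<open>Viewing the addition of a fibre as the multiplication of a monoid record makes
  \<open>finprod\<close> available for finite sums of vectors.\<close>

lemma comm_monoid: "comm_monoid \<lparr>carrier = V, monoid.mult = add, one = zero\<rparr>"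
  by (rule comm_monoidI) (simp_all add: closed add_assoc zero_add, simp add: add_commute)

end

text \<open>Passes from continuity on a subspace of a product to open boxes. The restriction to
  pairs in \<open>S\<close> stays in the conclusion because addition is controlled only on pairs
  from a common fibre.\<close>

lemma continuous_map_subtopology_prod_nhd:
  assumes f: "continuous_map (subtopology (prod_topology X Y) S) Z f"
    and xy: "(x, y) \<in> S" "x \<in> topspace X" "y \<in> topspace Y"
    and W: "openin Z W" "f (x, y) \<in> W"
  obtains A B where "openin X A" "openin Y B" "x \<in> A" "y \<in> B"
    "\<And>a b. a \<in> A \<Longrightarrow> b \<in> B \<Longrightarrow> (a, b) \<in> S \<Longrightarrow> f (a, b) \<in> W"
proof -
  have "openin (subtopology (prod_topology X Y) S)
          {z \<in> topspace (subtopology (prod_topology X Y) S). f z \<in> W}"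
    using f W(1) by (simp add: continuous_map)
  then obtain T where T: "openin (prod_topology X Y) T"
      "{z \<in> topspace (subtopology (prod_topology X Y) S). f z \<in> W} = T \<inter> S"
    unfolding openin_subtopology by blast
  have "(x, y) \<in> T"
    using T(2) xy W(2) by auto
  then have "\<exists>A B. openin X A \<and> openin Y B \<and> x \<in> A \<and> y \<in> B \<and> A \<times> B \<subseteq> T"
    using T(1) by (simp add: openin_prod_topology_alt)
  then obtain A B where AB: "openin X A" "openin Y B" "x \<in> A" "y \<in> B" "A \<times> B \<subseteq> T"
    by (elim exE conjE)
  have "f (a, b) \<in> W" if "a \<in> A" "b \<in> B" "(a, b) \<in> S" for a b
  proof -
    have "(a, b) \<in> T \<inter> S"
      using that AB(5) by blast
    then show ?thesis
      unfolding T(2)[symmetric] by blast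
  qed
  then show ?thesis
    using that AB(1-4) by metis
qed

section \<open>Distance and finite sums in the fibres of a bundle\<close>

context banach_bundle
begin

abbreviation "E \<equiv> bundle_space \<xi>"
abbreviation "p \<equiv> bundle_proj \<xi>"

text \<open>Serves as a metric on each fibre separately; for points of different fibres the value
  has no meaning.\<close>

definition fib_dist :: "'e \<Rightarrow> 'e \<Rightarrow> real" where
  "fib_dist x y = fib_norm \<xi> (fib_add \<xi> x (fib_scale \<xi> (- 1) y))"

text \<open>The base point \<open>t\<close> is an argument because the empty sum has to be the
  origin of a particular fibre.\<close>

definition fib_sum :: "'t \<Rightarrow> ('i \<Rightarrow> 'e) \<Rightarrow> 'i set \<Rightarrow> 'e" where
  "fib_sum t x F = finprod \<lparr>carrier = fiber \<xi> t, monoid.mult = fib_add \<xi>, one = fib_zero \<xi> t\<rparr> x F"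

lemma mem_fiber_iff: "x \<in> fiber \<xi> t \<longleftrightarrow> x \<in> topspace E \<and> p x = t"
  by (simp add: fiber_def)

lemma base_eq: "topspace (base_space \<xi>) = p ` topspace E"
  using surj_proj by simp

lemma fiber_base: "x \<in> fiber \<xi> t \<Longrightarrow> t \<in> topspace (base_space \<xi>)"
  by (auto simp: mem_fiber_iff base_eq)

lemma real_banach_fiber:
  assumes "t \<in> topspace (base_space \<xi>)"
  shows "real_banach_space_on K (fiber \<xi> t) (fib_add \<xi>) (fib_scale \<xi>) (fib_zero \<xi> t) (fib_norm \<xi>)"
proof -
  interpret banach_space_on K "fiber \<xi> t" "fib_add \<xi>" "fib_scale \<xi>" "fib_zero \<xi> t" "fib_norm \<xi>"
    using banach_fiber[OF assms] .
  show ?thesis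
    by unfold_locales (use scalars in auto)
qed

lemma fib_dist_eq:
  assumes "x \<in> fiber \<xi> t"
  shows "fib_dist u v = fib_norm \<xi> (real_banach_space_on.dif (fib_add \<xi>) (fib_scale \<xi>) u v)"
  unfolding fib_dist_def real_banach_space_on.dif_def[OF real_banach_fiber[OF fiber_base[OF assms]]] ..

lemma of_real_scalar: "of_real r \<in> K"
  using scalars by auto

lemma fib_add_closed: "\<lbrakk>x \<in> fiber \<xi> t; y \<in> fiber \<xi> t\<rbrakk> \<Longrightarrow> fib_add \<xi> x y \<in> fiber \<xi> t"
  using banach_space_on.add_closed[OF banach_fiber[OF fiber_base]] by blast

lemma fib_scale_closed: "\<lbrakk>c \<in> K; x \<in> fiber \<xi> t\<rbrakk> \<Longrightarrow> fib_scale \<xi> c x \<in> fiber \<xi> t"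
  using banach_space_on.scale_closed[OF banach_fiber[OF fiber_base]] by blast

lemma fib_zero_closed: "t \<in> topspace (base_space \<xi>) \<Longrightarrow> fib_zero \<xi> t \<in> fiber \<xi> t"
  using banach_space_on.zero_closed[OF banach_fiber] by blast

lemma fib_scale_zero_left: "x \<in> fiber \<xi> t \<Longrightarrow> fib_scale \<xi> 0 x = fib_zero \<xi> t"
  using real_banach_space_on.scale_zero_left[OF real_banach_fiber[OF fiber_base]] by blast

lemma fib_norm_zero: "t \<in> topspace (base_space \<xi>) \<Longrightarrow> fib_norm \<xi> (fib_zero \<xi> t) = 0"
  using real_banach_space_on.nrm_zero[OF real_banach_fiber] by blast

lemma fib_dist_self: "x \<in> fiber \<xi> t \<Longrightarrow> fib_dist x x = 0"
  unfolding fib_dist_def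
  using real_banach_space_on.add_neg[OF real_banach_fiber[OF fiber_base]] fib_norm_zero fiber_base
  by metis

lemma fib_diff_closed:
  "\<lbrakk>x \<in> fiber \<xi> t; y \<in> fiber \<xi> t\<rbrakk> \<Longrightarrow> fib_add \<xi> x (fib_scale \<xi> (- 1) y) \<in> fiber \<xi> t"
  using of_real_scalar[of "- 1"] by (simp add: fib_add_closed fib_scale_closed)

lemma fib_dist_commute:
  assumes "x \<in> fiber \<xi> t" "y \<in> fiber \<xi> t" shows "fib_dist x y = fib_dist y x"
  unfolding fib_dist_eq[OF assms(1)]
  using real_banach_space_on.nrm_dif_commute[OF real_banach_fiber[OF fiber_base]] assms by metis

lemma fib_dist_triangle:
  assumes "x \<in> fiber \<xi> t" "y \<in> fiber \<xi> t" "z \<in> fiber \<xi> t"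
  shows "fib_dist x z \<le> fib_dist x y + fib_dist y z"
  unfolding fib_dist_eq[OF assms(1)]
  by (rule real_banach_space_on.nrm_dif_triangle[OF real_banach_fiber[OF fiber_base]]) (fact assms)+

lemma fib_dist_add:
  assumes "a \<in> fiber \<xi> t" "b \<in> fiber \<xi> t" "c \<in> fiber \<xi> t" "d \<in> fiber \<xi> t"
  shows "fib_dist (fib_add \<xi> a b) (fib_add \<xi> c d) \<le> fib_dist a c + fib_dist b d"
  unfolding fib_dist_eq[OF assms(1)]
  by (rule real_banach_space_on.nrm_dif_add[OF real_banach_fiber[OF fiber_base]]) (fact assms)+

lemma fib_dist_scale:
  assumes "x \<in> fiber \<xi> t" "y \<in> fiber \<xi> t"
  shows "fib_dist (fib_scale \<xi> (of_real r) x) (fib_scale \<xi> (of_real r) y) = \<bar>r\<bar> * fib_dist x y"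
  unfolding fib_dist_eq[OF assms(1)]
  by (rule real_banach_space_on.nrm_dif_scale[OF real_banach_fiber[OF fiber_base]]) (fact assms)+

lemma fib_add_diff:
  assumes "x \<in> fiber \<xi> t" "y \<in> fiber \<xi> t"
  shows "fib_add \<xi> y (fib_add \<xi> x (fib_scale \<xi> (- 1) y)) = x"
  using real_banach_space_on.add_dif_cancel[OF real_banach_fiber[OF fiber_base], OF assms(1) assms]
  unfolding real_banach_space_on.dif_def[OF real_banach_fiber[OF fiber_base[OF assms(1)]]] .

lemma fib_add_zero: "x \<in> fiber \<xi> t \<Longrightarrow> fib_add \<xi> x (fib_zero \<xi> t) = x"
  using banach_space_on.add_zero[OF banach_fiber[OF fiber_base]] by blast

lemma fib_sum_empty: "t \<in> topspace (base_space \<xi>) \<Longrightarrow> fib_sum t x {} = fib_zero \<xi> t"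
  using comm_monoid.finprod_empty[OF real_banach_space_on.comm_monoid[OF real_banach_fiber]]
  by (simp add: fib_sum_def)

lemma fib_sum_closed:
  assumes "t \<in> topspace (base_space \<xi>)" "\<And>i. i \<in> F \<Longrightarrow> x i \<in> fiber \<xi> t"
  shows "fib_sum t x F \<in> fiber \<xi> t"
  using comm_monoid.finprod_closed[OF real_banach_space_on.comm_monoid[OF real_banach_fiber[OF assms(1)]], of x F]
    assms(2) by (auto simp: fib_sum_def)

lemma fib_sum_insert:
  assumes "finite F" "i \<notin> F" "\<And>j. j \<in> insert i F \<Longrightarrow> x j \<in> fiber \<xi> t"
  shows "fib_sum t x (insert i F) = fib_add \<xi> (x i) (fib_sum t x F)"
proof -
  have "t \<in> topspace (base_space \<xi>)"
    using assms(3) fiber_base by blast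
  from comm_monoid.finprod_insert[OF real_banach_space_on.comm_monoid[OF real_banach_fiber[OF this]] assms(1,2), of x]
  show ?thesis
    using assms(3) by (auto simp: fib_sum_def)
qed

lemma fib_sum_mono_neutral:
  assumes "t \<in> topspace (base_space \<xi>)" "finite G" "F \<subseteq> G" "\<And>i. i \<in> G \<Longrightarrow> x i \<in> fiber \<xi> t"
    "\<And>i. i \<in> G - F \<Longrightarrow> x i = fib_zero \<xi> t"
  shows "fib_sum t x F = fib_sum t x G"
  unfolding fib_sum_def
  by (rule comm_monoid.finprod_mono_neutral_cong_left[OF
        real_banach_space_on.comm_monoid[OF real_banach_fiber[OF assms(1)]]])
     (use assms in auto)

lemma mem_fiber_self: "x \<in> topspace E \<Longrightarrow> x \<in> fiber \<xi> (p x)"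
  by (simp add: mem_fiber_iff)

section \<open>Neighbourhood forms of the bundle axioms\<close>

lemma add_nhd:
  assumes "x \<in> fiber \<xi> t" "y \<in> fiber \<xi> t" "openin E W" "fib_add \<xi> x y \<in> W"
  obtains A B where "openin E A" "openin E B" "x \<in> A" "y \<in> B"
    "\<And>a b. a \<in> A \<Longrightarrow> b \<in> B \<Longrightarrow> p a = p b \<Longrightarrow> fib_add \<xi> a b \<in> W"
proof -
  have "(x, y) \<in> {(x, y). p x = p y}" "x \<in> topspace E" "y \<in> topspace E"
    "(\<lambda>(x, y). fib_add \<xi> x y) (x, y) \<in> W"
    using assms by (auto simp: mem_fiber_iff)
  from continuous_map_subtopology_prod_nhd[OF continuous_add this(1-3) assms(3) this(4)]
  obtain A B where "openin E A" "openin E B" "x \<in> A" "y \<in> B"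
    "\<And>a b. a \<in> A \<Longrightarrow> b \<in> B \<Longrightarrow> (a, b) \<in> {(x, y). p x = p y} \<Longrightarrow> (\<lambda>(x, y). fib_add \<xi> x y) (a, b) \<in> W"
    by blast
  then show ?thesis
    by (intro that[of A B]) simp_all
qed

text \<open>\<open>C\<close> is open in the complex plane, with membership in \<open>K\<close> as a
  separate condition, so that convergence of real weights can be used directly as complex
  convergence.\<close>

lemma scale_nhd:
  assumes "c \<in> K" "x \<in> topspace E" "openin E W" "fib_scale \<xi> c x \<in> W"
  obtains C A where "open C" "openin E A" "c \<in> C" "x \<in> A"
    "\<And>d a. d \<in> C \<Longrightarrow> d \<in> K \<Longrightarrow> a \<in> A \<Longrightarrow> fib_scale \<xi> d a \<in> W"
proof -
  have cont: "continuous_map (subtopology (prod_topology (top_of_set K) E) UNIV) E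
     (\<lambda>(c, x). fib_scale \<xi> c x)"
    using continuous_scale by simp
  have c: "c \<in> topspace (top_of_set K)" "(\<lambda>(c, x). fib_scale \<xi> c x) (c, x) \<in> W"
    using assms by simp_all
  from continuous_map_subtopology_prod_nhd[OF cont UNIV_I c(1) assms(2,3) c(2)]
  obtain C A where CA: "openin (top_of_set K) C" "openin E A" "c \<in> C" "x \<in> A"
    "\<And>d a. d \<in> C \<Longrightarrow> a \<in> A \<Longrightarrow> (d, a) \<in> UNIV \<Longrightarrow> (\<lambda>(c, x). fib_scale \<xi> c x) (d, a) \<in> W"
    by blast
  obtain C' where "open C'" "C = K \<inter> C'"
    using CA(1) openin_open by blast
  then show ?thesis
    using CA by (intro that[of C' A]) simp_all
qed

text \<open>Upper semicontinuity of the norm, pulled back along the continuous difference map: a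
  strict upper bound on a distance persists nearby in the same fibres. Lower bounds need not
  persist, so all later estimates are upper bounds.\<close>

lemma dist_nhd:
  assumes "x \<in> fiber \<xi> t" "y \<in> fiber \<xi> t" "fib_dist x y < e"
  obtains A B where "openin E A" "openin E B" "x \<in> A" "y \<in> B"
    "\<And>a b. a \<in> A \<Longrightarrow> b \<in> B \<Longrightarrow> p a = p b \<Longrightarrow> fib_dist a b < e"
proof -
  let ?W = "{z \<in> topspace E. fib_norm \<xi> z < e}"
  have m1: "- 1 \<in> K"
    using of_real_scalar[of "- 1"] by simp
  have "fib_add \<xi> x (fib_scale \<xi> (- 1) y) \<in> ?W"
    using fib_diff_closed[OF assms(1,2)] assms(3) by (simp add: fib_dist_def mem_fiber_iff)
  from add_nhd[OF assms(1) fib_scale_closed[OF m1 assms(2)] upper_semicontinuous_norm this]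
  obtain A B where AB: "openin E A" "openin E B" "x \<in> A" "fib_scale \<xi> (- 1) y \<in> B"
    "\<And>a b. a \<in> A \<Longrightarrow> b \<in> B \<Longrightarrow> p a = p b \<Longrightarrow> fib_add \<xi> a b \<in> ?W"
    by blast
  have "y \<in> topspace E"
    using assms(2) by (simp add: mem_fiber_iff)
  from scale_nhd[OF m1 this AB(2,4)]
  obtain C D where "open C" and CD: "openin E D" "- 1 \<in> C" "y \<in> D"
    "\<And>d a. d \<in> C \<Longrightarrow> d \<in> K \<Longrightarrow> a \<in> D \<Longrightarrow> fib_scale \<xi> d a \<in> B"
    by metis
  show ?thesis
  proof (rule that[OF AB(1) CD(1) AB(3) CD(3)])
    fix a b assume ab: "a \<in> A" "b \<in> D" "p a = p b"
    have "b \<in> topspace E"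
      using CD(1) ab(2) openin_subset by blast
    then have "p (fib_scale \<xi> (- 1) b) = p b"
      using fib_scale_closed[OF m1 mem_fiber_self] by (simp add: mem_fiber_iff)
    then show "fib_dist a b < e"
      using AB(5)[OF ab(1) CD(4)[OF CD(2) m1 ab(2)]] ab(3) by (simp add: fib_dist_def)
  qed
qed

text \<open>The distance from \<open>x\<close> to itself is 0, so \<open>dist_nhd\<close> applies at
  the pair \<open>(x, x)\<close>. Arbitrary choices made inside such a thin set differ by less than
  \<open>e\<close> in each fibre, which is what allows discontinuous selections later.\<close>

lemma thin_nhd:
  assumes "x \<in> topspace E" "0 < e"
  obtains A where "openin E A" "x \<in> A"
    "\<And>a b. a \<in> A \<Longrightarrow> b \<in> A \<Longrightarrow> p a = p b \<Longrightarrow> fib_dist a b < e"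
proof -
  note x = mem_fiber_self[OF assms(1)]
  have "fib_dist x x < e"
    using fib_dist_self[OF x] assms(2) by simp
  from dist_nhd[OF x x this]
  obtain A B where "openin E A" "openin E B" "x \<in> A" "x \<in> B"
    "\<And>a b. a \<in> A \<Longrightarrow> b \<in> B \<Longrightarrow> p a = p b \<Longrightarrow> fib_dist a b < e"
    by blast
  then show ?thesis
    by (intro that[of "A \<inter> B"]) auto
qed

text \<open>Near a point \<open>a\<close> close to \<open>w\<close>, distances to points near
  \<open>w\<close> stay below \<open>e\<close>, but the neighbouring fibres must also contain points
  of \<open>W\<close> near \<open>w\<close>. Openness of the projection provides this: the fibres
  meeting \<open>B \<inter> W\<close> lie over an open subset of the base.\<close>

lemma openin_thickening:
  assumes "openin E W"
  shows "openin E {a \<in> topspace E. \<exists>w\<in>W. p w = p a \<and> fib_dist a w < e}" (is "openin E ?S")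
proof (subst openin_subopen, safe)
  fix a w assume a: "a \<in> topspace E" "w \<in> W" "p w = p a" "fib_dist a w < e"
  have "w \<in> fiber \<xi> (p a)"
    using a openin_subset[OF assms] by (auto simp: mem_fiber_iff)
  from dist_nhd[OF mem_fiber_self[OF a(1)] this a(4)]
  obtain A B where AB: "openin E A" "openin E B" "a \<in> A" "w \<in> B"
    "\<And>a b. a \<in> A \<Longrightarrow> b \<in> B \<Longrightarrow> p a = p b \<Longrightarrow> fib_dist a b < e"
    by blast
  let ?P = "p ` (B \<inter> W)"
  have "openin (base_space \<xi>) ?P"
    using open_proj AB(2) assms by (simp add: open_map_def openin_Int)
  then have "openin E {x \<in> topspace E. p x \<in> ?P}"
    using continuous_proj openin_continuous_map_preimage by blast
  then have "openin E (A \<inter> {x \<in> topspace E. p x \<in> ?P})"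
    using AB(1) by blast
  moreover have "a \<in> A \<inter> {x \<in> topspace E. p x \<in> ?P}"
    using a AB(3,4) by (auto simp flip: a(3))
  moreover have "A \<inter> {x \<in> topspace E. p x \<in> ?P} \<subseteq> ?S"
  proof
    fix x assume x: "x \<in> A \<inter> {x \<in> topspace E. p x \<in> ?P}"
    then obtain v where "v \<in> B" "v \<in> W" "p x = p v"
      by auto
    then show "x \<in> ?S"
      using x AB(5)[of x v] by auto
  qed
  ultimately show "\<exists>T. openin E T \<and> a \<in> T \<and> T \<subseteq> ?S"
    by blast
qed

text \<open>Turns the axiom on nets into a description of neighbourhoods of an origin: each contains
  a tube of vectors of small norm over a neighbourhood of the base point.\<close>

lemma zero_nhd:
  assumes "t \<in> topspace (base_space \<xi>)" "openin E W" "fib_zero \<xi> t \<in> W"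
  obtains V e where "openin (base_space \<xi>) V" "t \<in> V" "0 < e"
    "\<And>z. z \<in> topspace E \<Longrightarrow> p z \<in> V \<Longrightarrow> fib_norm \<xi> z < e \<Longrightarrow> z \<in> W"
proof -
  \<comment> \<open>The coarsest filter on the total space along which the projection tends to
    \<open>t\<close> and the norm tends to 0; convergence of this single filter to the origin
    already yields the tube.\<close>
  define F where "F = inf (inf (filtercomap p (nhdsin (base_space \<xi>) t))
     (filtercomap (fib_norm \<xi>) (nhds 0))) (principal (topspace E))"
  have "F \<le> principal (topspace E)" "F \<le> filtercomap p (nhdsin (base_space \<xi>) t)"
    "F \<le> filtercomap (fib_norm \<xi>) (nhds 0)"
    unfolding F_def by (auto intro: le_infI1 le_infI2)
  note F = this
  have "eventually (\<lambda>x. x \<in> topspace E) F"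
    using F(1) by (simp add: le_principal)
  moreover have "limitin (base_space \<xi>) p t F"
    unfolding limitin_def
  proof (intro conjI allI impI assms(1))
    fix U assume U: "openin (base_space \<xi>) U \<and> t \<in> U"
    then have "eventually (\<lambda>s. s \<in> U) (nhdsin (base_space \<xi>) t)"
      by (auto simp: eventually_nhdsin)
    then have "eventually (\<lambda>x. p x \<in> U) (filtercomap p (nhdsin (base_space \<xi>) t))"
      by (rule eventually_filtercomapI)
    then show "eventually (\<lambda>x. p x \<in> U) F"
      using F(2) by (rule filter_leD[rotated])
  qed
  moreover have "(fib_norm \<xi> \<longlongrightarrow> 0) F"
    using F(3) by (rule filterlim_mono[OF filterlim_filtercomap order_refl])
  ultimately have "limitin E (\<lambda>x. x) (fib_zero \<xi> t) F"
    by (rule tendsto_zero)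
  then have "eventually (\<lambda>x. x \<in> W) F"
    using assms(2,3) by (simp add: limitin_def)
  then obtain P where P: "eventually P (inf (filtercomap p (nhdsin (base_space \<xi>) t))
     (filtercomap (fib_norm \<xi>) (nhds 0)))" "\<And>x. P x \<Longrightarrow> x \<in> topspace E \<Longrightarrow> x \<in> W"
    unfolding F_def eventually_inf_principal by blast
  obtain Q R where QR: "eventually Q (nhdsin (base_space \<xi>) t)" "eventually R (nhds (0::real))"
     "\<And>x. Q (p x) \<Longrightarrow> R (fib_norm \<xi> x) \<Longrightarrow> P x"
    using P(1) unfolding eventually_inf eventually_filtercomap by blast
  obtain V where V: "openin (base_space \<xi>) V" "t \<in> V" "\<And>s. s \<in> V \<Longrightarrow> Q s"
    using QR(1) assms(1) unfolding eventually_nhdsin by blast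
  obtain e where e: "0 < e" "\<And>r. \<bar>r\<bar> < e \<Longrightarrow> R r"
    using QR(2) unfolding eventually_nhds_metric dist_real_def by auto
  show ?thesis
  proof (rule that[OF V(1,2) e(1)])
    fix z assume z: "z \<in> topspace E" "p z \<in> V" "fib_norm \<xi> z < e"
    \<comment> \<open>The filter bounds the absolute value of the norm; as norms are nonnegative,
      the bound from above suffices.\<close>
    have "p z \<in> topspace (base_space \<xi>)"
      using z(1) by (simp add: base_eq)
    then have "0 \<le> fib_norm \<xi> z"
      using banach_space_on.nrm_nonneg[OF banach_fiber mem_fiber_self[OF z(1)]] by simp
    then show "z \<in> W"
      using z by (intro P(2) QR(3) V(3) e(2)) auto
  qed
qed

text \<open>Write \<open>z\<close> as \<open>a\<close> plus the difference of \<open>z\<close> and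
  \<open>a\<close>. By continuity of addition at \<open>x\<close> and the origin, the sum lies in
  \<open>W\<close> once \<open>a\<close> is near \<open>x\<close> and the difference is near the
  origin. By \<open>zero_nhd\<close> the latter is a bound on the norm, with the same
  \<open>e\<close> for all \<open>a\<close> in \<open>A\<close>.\<close>

lemma uniform_nhd:
  assumes "openin E W" "x \<in> W"
  obtains A e where "openin E A" "x \<in> A" "0 < e"
    "\<And>a z. a \<in> A \<Longrightarrow> z \<in> topspace E \<Longrightarrow> p z = p a \<Longrightarrow> fib_dist z a < e \<Longrightarrow> z \<in> W"
proof -
  have xE: "x \<in> topspace E"
    using assms openin_subset by blast
  note x = mem_fiber_self[OF xE]
  note t = fiber_base[OF x]
  have "fib_add \<xi> x (fib_zero \<xi> (p x)) \<in> W"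
    using fib_add_zero[OF x] assms(2) by simp
  from add_nhd[OF x fib_zero_closed[OF t] assms(1) this]
  obtain A B where AB: "openin E A" "openin E B" "x \<in> A" "fib_zero \<xi> (p x) \<in> B"
    "\<And>a b. a \<in> A \<Longrightarrow> b \<in> B \<Longrightarrow> p a = p b \<Longrightarrow> fib_add \<xi> a b \<in> W"
    by blast
  from zero_nhd[OF t AB(2,4)]
  obtain V e where V: "openin (base_space \<xi>) V" "p x \<in> V" "0 < e"
    "\<And>z. z \<in> topspace E \<Longrightarrow> p z \<in> V \<Longrightarrow> fib_norm \<xi> z < e \<Longrightarrow> z \<in> B"
    by blast
  show ?thesis
  proof (rule that)
    show "openin E (A \<inter> {a \<in> topspace E. p a \<in> V})"
      using AB(1) V(1) openin_continuous_map_preimage[OF continuous_proj] by blast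
    show "x \<in> A \<inter> {a \<in> topspace E. p a \<in> V}"
      using AB(3) xE V(2) by simp
    show "0 < e"
      by (fact V(3))
    fix a z
    assume a: "a \<in> A \<inter> {a \<in> topspace E. p a \<in> V}" and z: "z \<in> topspace E" "p z = p a" "fib_dist z a < e"
    have za: "z \<in> fiber \<xi> (p a)" "a \<in> fiber \<xi> (p a)"
      using a z by (auto simp: mem_fiber_iff)
    let ?d = "fib_add \<xi> z (fib_scale \<xi> (- 1) a)"
    have d: "?d \<in> topspace E" "p ?d = p a"
      using fib_diff_closed[OF za] by (auto simp: mem_fiber_iff)
    have "?d \<in> B"
      using d a z(3) by (intro V(4)) (auto simp: fib_dist_def)
    then have "fib_add \<xi> a ?d \<in> W"
      using AB(5)[of a ?d] a d(2) by simp
    then show "z \<in> W"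
      using fib_add_diff[OF za] by simp
  qed
qed

section \<open>Convex combinations and complete limits in a fibre\<close>

lemma fib_sum_dist:
  assumes "t \<in> topspace (base_space \<xi>)" "finite F"
    and "\<And>i. i \<in> F \<Longrightarrow> x i \<in> fiber \<xi> t" "\<And>i. i \<in> F \<Longrightarrow> y i \<in> fiber \<xi> t"
  shows "fib_dist (fib_sum t x F) (fib_sum t y F) \<le> (\<Sum>i\<in>F. fib_dist (x i) (y i))"
  using assms(2-4)
proof (induction F rule: finite_induct)
  case empty
  show ?case
    using fib_dist_self[OF fib_zero_closed[OF assms(1)]] by (simp add: fib_sum_empty assms(1))
next
  case (insert i F)
  have c: "x i \<in> fiber \<xi> t" "y i \<in> fiber \<xi> t" "fib_sum t x F \<in> fiber \<xi> t" "fib_sum t y F \<in> fiber \<xi> t"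
    using insert.prems by (auto intro!: fib_sum_closed[OF assms(1)])
  have IH: "fib_dist (fib_sum t x F) (fib_sum t y F) \<le> (\<Sum>i\<in>F. fib_dist (x i) (y i))"
    using insert.prems by (intro insert.IH) auto
  have eq: "fib_sum t x (insert i F) = fib_add \<xi> (x i) (fib_sum t x F)"
    "fib_sum t y (insert i F) = fib_add \<xi> (y i) (fib_sum t y F)"
    using insert.hyps insert.prems by (intro fib_sum_insert; blast)+
  show ?case
    unfolding eq using fib_dist_add[OF c(1,3,2,4)] IH insert.hyps by simp
qed

lemma fib_sum_scale_const:
  assumes "a \<in> fiber \<xi> t" "finite F"
  shows "fib_sum t (\<lambda>i. fib_scale \<xi> (of_real (c i)) a) F = fib_scale \<xi> (of_real (sum c F)) a"
  using assms(2)
proof (induction F rule: finite_induct)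
  case empty
  show ?case
    using assms(1) by (simp add: fib_sum_empty fiber_base fib_scale_zero_left)
next
  case (insert i F)
  have "fib_sum t (\<lambda>i. fib_scale \<xi> (of_real (c i)) a) (insert i F)
      = fib_add \<xi> (fib_scale \<xi> (of_real (c i)) a) (fib_scale \<xi> (of_real (sum c F)) a)"
    using insert.hyps fib_scale_closed[OF of_real_scalar assms(1)]
    by (subst fib_sum_insert) (auto simp: insert.IH)
  also have "\<dots> = fib_scale \<xi> (of_real (c i) + of_real (sum c F)) a"
    by (rule banach_space_on.scale_add_left[OF banach_fiber[OF fiber_base[OF assms(1)]]
        of_real_scalar of_real_scalar assms(1), symmetric])
  finally show ?case
    using insert.hyps by simp
qed

lemma fib_scale_one: "x \<in> fiber \<xi> t \<Longrightarrow> fib_scale \<xi> (of_real 1) x = x"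
  using banach_space_on.scale_one[OF banach_fiber[OF fiber_base]] by simp

text \<open>Balls are convex: \<open>a\<close> is itself the combination of copies of
  \<open>a\<close> with the same weights, so the two combinations can be compared term by
  term.\<close>

lemma fib_dist_convex_combination:
  assumes a: "a \<in> fiber \<xi> t" and F: "finite F" "sum c F = 1"
    and x: "\<And>i. i \<in> F \<Longrightarrow> x i \<in> fiber \<xi> t" "\<And>i. i \<in> F \<Longrightarrow> fib_dist (x i) a \<le> r"
    and c: "\<And>i. i \<in> F \<Longrightarrow> 0 \<le> c i"
  shows "fib_dist (fib_sum t (\<lambda>i. fib_scale \<xi> (of_real (c i)) (x i)) F) a \<le> r"
proof -
  let ?s = "\<lambda>x i. fib_scale \<xi> (of_real (c i)) (x i)"
  have "fib_sum t (?s (\<lambda>i. a)) F = a"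
    unfolding fib_sum_scale_const[OF a F(1)] F(2) by (rule fib_scale_one[OF a])
  then have "fib_dist (fib_sum t (?s x) F) a
      = fib_dist (fib_sum t (?s x) F) (fib_sum t (?s (\<lambda>i. a)) F)"
    by simp
  also have "\<dots> \<le> (\<Sum>i\<in>F. fib_dist (?s x i) (?s (\<lambda>i. a) i))"
    using a x by (intro fib_sum_dist F fib_scale_closed of_real_scalar fiber_base[OF a])
  also have "\<dots> = (\<Sum>i\<in>F. c i * fib_dist (x i) a)"
    using c by (intro sum.cong refl) (simp add: fib_dist_scale[OF x(1) a])
  also have "\<dots> \<le> (\<Sum>i\<in>F. c i * r)"
    using x c by (intro sum_mono mult_left_mono)
  also have "\<dots> = r"
    using F(2) by (simp flip: sum_distrib_right)
  finally show ?thesis .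
qed

text \<open>Completeness provides \<open>l\<close>; the bound passes to the limit by the triangle
  inequality through a later term \<open>s m\<close>, letting \<open>m\<close> tend to
  infinity.\<close>

lemma fib_dist_complete:
  assumes t: "t \<in> topspace (base_space \<xi>)" and s: "\<And>n. s n \<in> fiber \<xi> t"
    and bound: "\<And>n k. fib_dist (s (n + k)) (s n) \<le> b n" and b: "b \<longlonglongrightarrow> 0"
  obtains l where "l \<in> fiber \<xi> t" "\<And>n. fib_dist (s n) l \<le> b n" "(\<lambda>n. fib_dist (s n) l) \<longlonglongrightarrow> 0"
proof -
  have bound': "fib_dist (s m) (s n) \<le> b n" if "n \<le> m" for m n
    using bound[of n "m - n"] that by simp
  have cauchy: "\<exists>N. \<forall>m\<ge>N. \<forall>n\<ge>N. fib_dist (s m) (s n) < e" if "0 < e" for e :: real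
  proof -
    have "\<forall>\<^sub>F n in sequentially. b n < e / 2"
      using order_tendstoD(2)[OF b, of "e / 2"] that by simp
    then obtain N where N: "b N < e / 2"
      unfolding eventually_sequentially by blast
    have "fib_dist (s m) (s n) < e" if "N \<le> m" "N \<le> n" for m n
      using fib_dist_triangle[OF s[of m] s[of N] s[of n]] bound'[OF that(1)] bound'[OF that(2)]
        fib_dist_commute[OF s[of N] s[of n]] N by linarith
    then show ?thesis
      by blast
  qed
  have "\<exists>l\<in>fiber \<xi> t. (\<lambda>n. fib_dist (s n) l) \<longlonglongrightarrow> 0"
    unfolding fib_dist_def
    by (rule banach_space_on.complete[OF banach_fiber[OF t], of s, OF s cauchy[unfolded fib_dist_def]])
  then obtain l where l: "l \<in> fiber \<xi> t" "(\<lambda>n. fib_dist (s n) l) \<longlonglongrightarrow> 0"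
    by blast
  have "fib_dist (s n) l \<le> b n" for n
  proof -
    have lim: "(\<lambda>m. b n + fib_dist (s m) l) \<longlonglongrightarrow> b n + 0"
      by (intro tendsto_add tendsto_const l(2))
    have "fib_dist (s n) l \<le> b n + fib_dist (s m) l" if "n \<le> m" for m
      using fib_dist_triangle[OF s s l(1), of n m] bound'[OF that] fib_dist_commute[OF s s, of n m]
      by linarith
    then have "fib_dist (s n) l \<le> b n + 0"
      by (intro Lim_bounded2[OF lim]) blast
    then show ?thesis
      by simp
  qed
  then show ?thesis
    using l by (intro that[of l])
qed

end

section \<open>Approximately continuous lifts\<close>

locale open_bundle_map = B1: banach_bundle K \<xi>1 + B2: banach_bundle K \<xi>2
  for K and \<xi>1 :: "('e1, 't) bundle_data" and \<xi>2 :: "('e2, 't) bundle_data" +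
  fixes \<phi> :: "'e1 \<Rightarrow> 'e2"
  assumes bundle_map: "banach_bundle_map K \<xi>1 \<xi>2 \<phi>"
    and open_\<phi>: "open_map (bundle_space \<xi>1) (bundle_space \<xi>2) \<phi>"
    and surj_\<phi>: "\<phi> ` topspace (bundle_space \<xi>1) = topspace (bundle_space \<xi>2)"
begin

lemma base_eq: "base_space \<xi>1 = base_space \<xi>2"
  using bundle_map by (simp add: banach_bundle_map_def)

lemma continuous_\<phi>: "continuous_map B1.E B2.E \<phi>"
  using bundle_map by (simp add: banach_bundle_map_def)

lemma \<phi>_fiber: "x \<in> fiber \<xi>1 t \<Longrightarrow> \<phi> x \<in> fiber \<xi>2 t"
  using bundle_map B1.fiber_base[of x t] by (simp add: banach_bundle_map_def image_subset_iff)

lemma \<phi>_add: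
  "\<lbrakk>x \<in> fiber \<xi>1 t; y \<in> fiber \<xi>1 t\<rbrakk> \<Longrightarrow> \<phi> (fib_add \<xi>1 x y) = fib_add \<xi>2 (\<phi> x) (\<phi> y)"
  using bundle_map B1.fiber_base[of x t] by (simp add: banach_bundle_map_def)

lemma \<phi>_scale:
  "\<lbrakk>c \<in> K; x \<in> fiber \<xi>1 t\<rbrakk> \<Longrightarrow> \<phi> (fib_scale \<xi>1 c x) = fib_scale \<xi>2 c (\<phi> x)"
  using bundle_map B1.fiber_base[of x t] by (simp add: banach_bundle_map_def)

lemma \<phi>_zero:
  assumes "t \<in> topspace (base_space \<xi>2)"
  shows "\<phi> (fib_zero \<xi>1 t) = fib_zero \<xi>2 t"
proof -
  have z: "fib_zero \<xi>1 t \<in> fiber \<xi>1 t"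
    using assms by (intro B1.fib_zero_closed) (simp add: base_eq)
  have "\<phi> (fib_scale \<xi>1 (of_real 0) (fib_zero \<xi>1 t)) = fib_scale \<xi>2 (of_real 0) (\<phi> (fib_zero \<xi>1 t))"
    by (rule \<phi>_scale[OF B1.of_real_scalar z])
  then show ?thesis
    using B1.fib_scale_zero_left[OF z] B2.fib_scale_zero_left[OF \<phi>_fiber[OF z]] by simp
qed

lemma proj_\<phi>: "x \<in> topspace B1.E \<Longrightarrow> B2.p (\<phi> x) = B1.p x"
  using \<phi>_fiber[OF B1.mem_fiber_self] by (simp add: B2.mem_fiber_iff)

lemma \<phi>_sum:
  assumes "t \<in> topspace (base_space \<xi>2)" "finite F" "\<And>i. i \<in> F \<Longrightarrow> x i \<in> fiber \<xi>1 t"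
  shows "\<phi> (B1.fib_sum t x F) = B2.fib_sum t (\<lambda>i. \<phi> (x i)) F"
  using assms(2,3)
proof (induction F rule: finite_induct)
  case empty
  show ?case
    using assms(1) base_eq by (simp add: B1.fib_sum_empty B2.fib_sum_empty \<phi>_zero)
next
  case (insert i F)
  have c: "x i \<in> fiber \<xi>1 t" "B1.fib_sum t x F \<in> fiber \<xi>1 t"
    using insert.prems assms(1) base_eq by (auto intro!: B1.fib_sum_closed)
  have eq: "B1.fib_sum t x (insert i F) = fib_add \<xi>1 (x i) (B1.fib_sum t x F)"
    using insert.hyps insert.prems by (intro B1.fib_sum_insert)
  have eq2: "B2.fib_sum t (\<lambda>i. \<phi> (x i)) (insert i F)
      = fib_add \<xi>2 (\<phi> (x i)) (B2.fib_sum t (\<lambda>i. \<phi> (x i)) F)"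
    using insert.hyps \<phi>_fiber[OF insert.prems] by (intro B2.fib_sum_insert)
  show ?case
    unfolding eq eq2 using \<phi>_add[OF c] insert by simp
qed

text \<open>By linearity the preimage of \<open>y\<close> is an affine subset of its fibre: the
  image of the combination is \<open>y\<close> scaled by the sum of the weights. Hence averaging
  sections of \<phi> gives sections again.\<close>

lemma \<phi>_convex_combination:
  assumes y: "y \<in> topspace B2.E" and F: "finite F" "sum c F = 1"
    and x: "\<And>i. i \<in> F \<Longrightarrow> x i \<in> topspace B1.E \<and> \<phi> (x i) = y"
  shows "\<phi> (B1.fib_sum (B2.p y) (\<lambda>i. fib_scale \<xi>1 (of_real (c i)) (x i)) F) = y"
proof -
  have xf: "x i \<in> fiber \<xi>1 (B2.p y)" if "i \<in> F" for i
    using x[OF that] proj_\<phi>[of "x i"] by (simp add: B1.mem_fiber_iff)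
  note yf = B2.mem_fiber_self[OF y]
  have "\<phi> (B1.fib_sum (B2.p y) (\<lambda>i. fib_scale \<xi>1 (of_real (c i)) (x i)) F)
      = B2.fib_sum (B2.p y) (\<lambda>i. \<phi> (fib_scale \<xi>1 (of_real (c i)) (x i))) F"
    using xf by (intro \<phi>_sum B2.fiber_base[OF yf] F B1.fib_scale_closed B1.of_real_scalar)
  also have "\<dots> = B2.fib_sum (B2.p y) (\<lambda>i. fib_scale \<xi>2 (of_real (c i)) y) F"
  proof -
    have eq: "\<phi> (fib_scale \<xi>1 (of_real (c i)) (x i)) = fib_scale \<xi>2 (of_real (c i)) y" if "i \<in> F" for i
      using \<phi>_scale[OF B1.of_real_scalar xf[OF that]] x[OF that] by simp
    show ?thesis
      unfolding B2.fib_sum_def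
      by (rule comm_monoid.finprod_cong'[OF real_banach_space_on.comm_monoid[OF
              B2.real_banach_fiber[OF B2.fiber_base[OF yf]]]])
        (use eq B2.fib_scale_closed[OF B1.of_real_scalar yf] in auto)
  qed
  also have "\<dots> = y"
    unfolding B2.fib_sum_scale_const[OF yf F(1)] F(2) by (rule B2.fib_scale_one[OF yf])
  finally show ?thesis .
qed

section \<open>Linear operations on approximately continuous lifts\<close>

definition lift :: "('e2 \<Rightarrow> 'e1) \<Rightarrow> bool" where
  "lift f \<longleftrightarrow> (\<forall>y\<in>topspace B2.E. f y \<in> fiber \<xi>1 (B2.p y))"

text \<open>The tolerance is a function of the point so that it can be multiplied by the weights of
  a partition of unity. The witness \<open>w\<close> must have the same image as \<open>f y\<close>
  because the refinement step uses it as an admissible new value over \<open>y\<close>. For a lift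
  and tolerance 0 the condition is continuity at \<open>y0\<close>.\<close>

definition approx_continuous :: "('e2 \<Rightarrow> real) \<Rightarrow> ('e2 \<Rightarrow> 'e1) \<Rightarrow> 'e2 \<Rightarrow> bool" where
  "approx_continuous e f y0 \<longleftrightarrow>
     (\<forall>W. openin B1.E W \<longrightarrow> f y0 \<in> W \<longrightarrow>
        (\<forall>\<^sub>F y in nhdsin B2.E y0. \<exists>w\<in>W. \<phi> w = \<phi> (f y) \<and> B1.fib_dist w (f y) \<le> e y))"

lemma liftD: "\<lbrakk>lift f; y \<in> topspace B2.E\<rbrakk> \<Longrightarrow> f y \<in> fiber \<xi>1 (B2.p y)"
  by (simp add: lift_def)

lemma approx_continuousD:
  "\<lbrakk>approx_continuous e f y0; openin B1.E W; f y0 \<in> W\<rbrakk>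
    \<Longrightarrow> \<forall>\<^sub>F y in nhdsin B2.E y0. \<exists>w\<in>W. \<phi> w = \<phi> (f y) \<and> B1.fib_dist w (f y) \<le> e y"
  by (simp add: approx_continuous_def)

lemma approx_continuous_cong:
  assumes f: "approx_continuous e f y0"
    and ev: "\<forall>\<^sub>F y in nhdsin B2.E y0. f y = g y \<and> e y \<le> e' y"
    and y0: "y0 \<in> topspace B2.E"
  shows "approx_continuous e' g y0"
  unfolding approx_continuous_def
proof (intro allI impI)
  fix W assume W: "openin B1.E W" "g y0 \<in> W"
  \<comment> \<open>The filter \<open>nhdsin\<close> retains the point \<open>y0\<close> itself, so
    the two maps agree there as well.\<close>
  have "f y0 = g y0"
    using ev y0 by (auto simp: eventually_nhdsin)
  with W have "\<forall>\<^sub>F y in nhdsin B2.E y0. \<exists>w\<in>W. \<phi> w = \<phi> (f y) \<and> B1.fib_dist w (f y) \<le> e y"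
    using approx_continuousD[OF f] by simp
  with ev show "\<forall>\<^sub>F y in nhdsin B2.E y0. \<exists>w\<in>W. \<phi> w = \<phi> (g y) \<and> B1.fib_dist w (g y) \<le> e' y"
  proof eventually_elim
    case (elim y)
    then obtain w where "w \<in> W" "\<phi> w = \<phi> (f y)" "B1.fib_dist w (f y) \<le> e y"
      by blast
    with elim(1) show ?case
      by (intro bexI[of _ w]) auto
  qed
qed

text \<open>Continuity of the zero section, a consequence of \<open>zero_nhd\<close>. It starts the
  induction for sums and handles summands that vanish near \<open>y0\<close>.\<close>

lemma approx_continuous_zero:
  assumes y0: "y0 \<in> topspace B2.E"
  shows "approx_continuous (\<lambda>_. 0) (\<lambda>y. fib_zero \<xi>1 (B2.p y)) y0"
  unfolding approx_continuous_def
proof (intro allI impI)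
  fix W assume W: "openin B1.E W" "fib_zero \<xi>1 (B2.p y0) \<in> W"
  have base: "B2.p y \<in> topspace (base_space \<xi>1)" if "y \<in> topspace B2.E" for y
    using B2.fiber_base[OF B2.mem_fiber_self[OF that]] by (simp add: base_eq)
  from B1.zero_nhd[OF base[OF y0] W]
  obtain V e where V: "openin (base_space \<xi>1) V" "B2.p y0 \<in> V" "0 < e"
    "\<And>z. z \<in> topspace B1.E \<Longrightarrow> B1.p z \<in> V \<Longrightarrow> fib_norm \<xi>1 z < e \<Longrightarrow> z \<in> W"
    by metis
  have "openin B2.E {y \<in> topspace B2.E. B2.p y \<in> V}"
    using openin_continuous_map_preimage[OF B2.continuous_proj] V(1) by (simp add: base_eq)
  then have "\<forall>\<^sub>F y in nhdsin B2.E y0. y \<in> {y \<in> topspace B2.E. B2.p y \<in> V}"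
    using y0 V(2) by (intro eventually_nhdsin_openin) auto
  then show "\<forall>\<^sub>F y in nhdsin B2.E y0. \<exists>w\<in>W. \<phi> w = \<phi> (fib_zero \<xi>1 (B2.p y)) \<and>
      B1.fib_dist w (fib_zero \<xi>1 (B2.p y)) \<le> 0"
  proof eventually_elim
    case (elim y)
    then have y: "B2.p y \<in> topspace (base_space \<xi>1)" "B2.p y \<in> V"
      using base by auto
    note z = B1.fib_zero_closed[OF y(1)]
    have "fib_zero \<xi>1 (B2.p y) \<in> W"
      using z y V(3) B1.fib_norm_zero[OF y(1)] by (intro V(4)) (auto simp: B1.mem_fiber_iff)
    then show ?case
      using B1.fib_dist_self[OF z] by auto
  qed
qed

lemma same_fiber:
  assumes "openin B1.E W" "w \<in> W" "lift f" "y \<in> topspace B2.E" "\<phi> w = \<phi> (f y)"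
  shows "w \<in> fiber \<xi>1 (B2.p y)"
proof -
  have "f y \<in> topspace B1.E" "w \<in> topspace B1.E" "B1.p (f y) = B2.p y"
    using liftD[OF assms(3,4)] assms(1,2) openin_subset by (auto simp: B1.mem_fiber_iff)
  then show ?thesis
    using proj_\<phi>[of w] proj_\<phi>[of "f y"] assms(5) by (simp add: B1.mem_fiber_iff)
qed

lemma lift_scale: "lift f \<Longrightarrow> lift (\<lambda>y. fib_scale \<xi>1 (of_real (h y)) (f y))"
  by (simp add: lift_def B1.fib_scale_closed B1.of_real_scalar)

lemma lift_sum:
  assumes "\<And>i. i \<in> F \<Longrightarrow> lift (f i)"
  shows "lift (\<lambda>y. B1.fib_sum (B2.p y) (\<lambda>i. f i y) F)"
  unfolding lift_def
proof
  fix y assume y: "y \<in> topspace B2.E"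
  have "B2.p y \<in> topspace (base_space \<xi>1)"
    using B2.fiber_base[OF B2.mem_fiber_self[OF y]] by (simp add: base_eq)
  then show "B1.fib_sum (B2.p y) (\<lambda>i. f i y) F \<in> fiber \<xi>1 (B2.p y)"
    using liftD[OF assms y] by (intro B1.fib_sum_closed)
qed

text \<open>The sum of the two witnesses is a witness for the sum: linearity of \<phi> gives it the
  right image, and the errors add by the triangle inequality.\<close>

lemma approx_continuous_add:
  assumes f: "approx_continuous d f y0" "lift f" and g: "approx_continuous e g y0" "lift g"
    and y0: "y0 \<in> topspace B2.E"
  shows "approx_continuous (\<lambda>y. d y + e y) (\<lambda>y. fib_add \<xi>1 (f y) (g y)) y0"
  unfolding approx_continuous_def
proof (intro allI impI)
  fix W assume W: "openin B1.E W" "fib_add \<xi>1 (f y0) (g y0) \<in> W"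
  from B1.add_nhd[OF liftD[OF f(2) y0] liftD[OF g(2) y0] W]
  obtain A B where AB: "openin B1.E A" "openin B1.E B" "f y0 \<in> A" "g y0 \<in> B"
    "\<And>a b. a \<in> A \<Longrightarrow> b \<in> B \<Longrightarrow> B1.p a = B1.p b \<Longrightarrow> fib_add \<xi>1 a b \<in> W"
    by blast
  from approx_continuousD[OF f(1) AB(1,3)] approx_continuousD[OF g(1) AB(2,4)]
    eventually_nhdsin_topspace
  show "\<forall>\<^sub>F y in nhdsin B2.E y0. \<exists>w\<in>W. \<phi> w = \<phi> (fib_add \<xi>1 (f y) (g y)) \<and>
      B1.fib_dist w (fib_add \<xi>1 (f y) (g y)) \<le> d y + e y"
  proof eventually_elim
    case (elim y)
    obtain a where a: "a \<in> A" "\<phi> a = \<phi> (f y)" "B1.fib_dist a (f y) \<le> d y"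
      using elim(1) by blast
    obtain b where b: "b \<in> B" "\<phi> b = \<phi> (g y)" "B1.fib_dist b (g y) \<le> e y"
      using elim(2) by blast
    note c = same_fiber[OF AB(1) a(1) f(2) elim(3) a(2)] same_fiber[OF AB(2) b(1) g(2) elim(3) b(2)]
      liftD[OF f(2) elim(3)] liftD[OF g(2) elim(3)]
    have "fib_add \<xi>1 a b \<in> W"
      using AB(5)[OF a(1) b(1)] c by (simp add: B1.mem_fiber_iff)
    moreover have "\<phi> (fib_add \<xi>1 a b) = \<phi> (fib_add \<xi>1 (f y) (g y))"
      unfolding \<phi>_add[OF c(1,2)] \<phi>_add[OF c(3,4)] a(2) b(2) ..
    moreover have "B1.fib_dist (fib_add \<xi>1 a b) (fib_add \<xi>1 (f y) (g y)) \<le> d y + e y"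
      using B1.fib_dist_add[OF c] a(3) b(3) by linarith
    ultimately show ?case
      by blast
  qed
qed

text \<open>The witness is scaled by the weight at the varying point \<open>y\<close>, so its error
  is scaled too; for weights with sum 1 the total tolerance therefore does not grow.\<close>

lemma approx_continuous_scale:
  assumes f: "approx_continuous e f y0" "lift f" and h: "(h \<longlongrightarrow> h y0) (nhdsin B2.E y0)"
    and y0: "y0 \<in> topspace B2.E"
  shows "approx_continuous (\<lambda>y. \<bar>h y\<bar> * e y) (\<lambda>y. fib_scale \<xi>1 (of_real (h y)) (f y)) y0"
  unfolding approx_continuous_def
proof (intro allI impI)
  fix W assume W: "openin B1.E W" "fib_scale \<xi>1 (of_real (h y0)) (f y0) \<in> W"
  have "f y0 \<in> topspace B1.E"
    using liftD[OF f(2) y0] by (simp add: B1.mem_fiber_iff)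
  from B1.scale_nhd[OF B1.of_real_scalar this W]
  obtain C A where CA: "open C" "openin B1.E A" "of_real (h y0) \<in> C" "f y0 \<in> A"
    "\<And>d a. d \<in> C \<Longrightarrow> d \<in> K \<Longrightarrow> a \<in> A \<Longrightarrow> fib_scale \<xi>1 d a \<in> W"
    by metis
  have "((\<lambda>y. of_real (h y) :: complex) \<longlongrightarrow> of_real (h y0)) (nhdsin B2.E y0)"
    using h by (rule tendsto_of_real)
  then have "\<forall>\<^sub>F y in nhdsin B2.E y0. of_real (h y) \<in> C"
    using CA(1,3) by (rule topological_tendstoD)
  with approx_continuousD[OF f(1) CA(2,4)] eventually_nhdsin_topspace
  show "\<forall>\<^sub>F y in nhdsin B2.E y0. \<exists>w\<in>W. \<phi> w = \<phi> (fib_scale \<xi>1 (of_real (h y)) (f y)) \<and>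
      B1.fib_dist w (fib_scale \<xi>1 (of_real (h y)) (f y)) \<le> \<bar>h y\<bar> * e y"
  proof eventually_elim
    case (elim y)
    obtain a where a: "a \<in> A" "\<phi> a = \<phi> (f y)" "B1.fib_dist a (f y) \<le> e y"
      using elim(1) by blast
    note c = same_fiber[OF CA(2) a(1) f(2) elim(2) a(2)] liftD[OF f(2) elim(2)]
    have "fib_scale \<xi>1 (of_real (h y)) a \<in> W"
      using CA(5)[OF elim(3) B1.of_real_scalar a(1)] .
    moreover have "\<phi> (fib_scale \<xi>1 (of_real (h y)) a) = \<phi> (fib_scale \<xi>1 (of_real (h y)) (f y))"
      unfolding \<phi>_scale[OF B1.of_real_scalar c(1)] \<phi>_scale[OF B1.of_real_scalar c(2)] a(2) ..
    moreover have "B1.fib_dist (fib_scale \<xi>1 (of_real (h y)) a) (fib_scale \<xi>1 (of_real (h y)) (f y))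
        \<le> \<bar>h y\<bar> * e y"
      unfolding B1.fib_dist_scale[OF c] using a(3) by (rule mult_left_mono) simp
    ultimately show ?case
      by blast
  qed
qed

lemma approx_continuous_sum:
  assumes y0: "y0 \<in> topspace B2.E" and "finite F"
    and "\<And>i. i \<in> F \<Longrightarrow> lift (f i)" "\<And>i. i \<in> F \<Longrightarrow> approx_continuous (e i) (f i) y0"
  shows "approx_continuous (\<lambda>y. \<Sum>i\<in>F. e i y) (\<lambda>y. B1.fib_sum (B2.p y) (\<lambda>i. f i y) F) y0"
  using assms(2-4)
proof (induction F rule: finite_induct)
  case empty
  have "\<forall>\<^sub>F y in nhdsin B2.E y0. fib_zero \<xi>1 (B2.p y) = B1.fib_sum (B2.p y) (\<lambda>i. f i y) {} \<and>
      0 \<le> (\<Sum>i\<in>{}. e i y)"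
    using eventually_nhdsin_topspace
  proof eventually_elim
    case (elim y)
    then show ?case
      using B2.fiber_base[OF B2.mem_fiber_self[OF elim]] base_eq by (simp add: B1.fib_sum_empty)
  qed
  from approx_continuous_cong[OF approx_continuous_zero[OF y0] this y0] show ?case .
next
  case (insert i F)
  have IH: "approx_continuous (\<lambda>y. \<Sum>i\<in>F. e i y) (\<lambda>y. B1.fib_sum (B2.p y) (\<lambda>i. f i y) F) y0"
    using insert.prems by (intro insert.IH) auto
  have "approx_continuous (\<lambda>y. e i y + (\<Sum>i\<in>F. e i y))
      (\<lambda>y. fib_add \<xi>1 (f i y) (B1.fib_sum (B2.p y) (\<lambda>i. f i y) F)) y0"
    using insert.prems by (intro approx_continuous_add IH y0 lift_sum) auto
  moreover have "\<forall>\<^sub>F y in nhdsin B2.E y0.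
      fib_add \<xi>1 (f i y) (B1.fib_sum (B2.p y) (\<lambda>i. f i y) F) = B1.fib_sum (B2.p y) (\<lambda>i. f i y) (insert i F)
      \<and> e i y + (\<Sum>i\<in>F. e i y) \<le> (\<Sum>i\<in>insert i F. e i y)"
    using eventually_nhdsin_topspace
  proof eventually_elim
    case (elim y)
    have "B1.fib_sum (B2.p y) (\<lambda>i. f i y) (insert i F) = fib_add \<xi>1 (f i y) (B1.fib_sum (B2.p y) (\<lambda>i. f i y) F)"
      using insert.hyps liftD[OF insert.prems(1) elim] by (intro B1.fib_sum_insert)
    then show ?case
      using insert.hyps by simp
  qed
  ultimately show ?case
    using y0 by (rule approx_continuous_cong)
qed

text \<open>Continuity of \<open>s\<close> is replaced by openness of \<phi>: the image of
  \<open>U \<inter> W\<close> is a neighbourhood of \<open>y0\<close>, so every nearby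
  \<open>y\<close> has a preimage in \<open>W\<close> that also lies in \<open>U\<close>, and
  thinness of \<open>U\<close> puts it within \<open>e\<close> of \<open>s y\<close>.\<close>

lemma approx_continuous_thin_lift:
  assumes y0: "y0 \<in> topspace B2.E" "s y0 \<in> U"
    and N: "openin B2.E N" "y0 \<in> N" and U: "openin B1.E U"
    and thin: "\<And>a b. a \<in> U \<Longrightarrow> b \<in> U \<Longrightarrow> B1.p a = B1.p b \<Longrightarrow> B1.fib_dist a b < e"
    and s: "\<And>y. y \<in> N \<Longrightarrow> s y \<in> U \<and> \<phi> (s y) = y"
  shows "approx_continuous (\<lambda>_. e) s y0"
  unfolding approx_continuous_def
proof (intro allI impI)
  fix W assume W: "openin B1.E W" "s y0 \<in> W"
  have "openin B2.E (\<phi> ` (U \<inter> W))"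
    using open_\<phi> U W(1) by (simp add: open_map_def openin_Int)
  moreover have "y0 \<in> \<phi> ` (U \<inter> W)"
    using s[OF N(2)] W(2) by (intro image_eqI[of _ _ "s y0"]) auto
  ultimately have "\<forall>\<^sub>F y in nhdsin B2.E y0. y \<in> \<phi> ` (U \<inter> W)"
    by (rule eventually_nhdsin_openin)
  with eventually_nhdsin_openin[OF N]
  show "\<forall>\<^sub>F y in nhdsin B2.E y0. \<exists>w\<in>W. \<phi> w = \<phi> (s y) \<and> B1.fib_dist w (s y) \<le> e"
  proof eventually_elim
    case (elim y)
    obtain w where w: "w \<in> U" "w \<in> W" "y = \<phi> w"
      using elim(2) by blast
    have "w \<in> topspace B1.E" "s y \<in> topspace B1.E"
      using openin_subset[OF U] w(1) s[OF elim(1)] by auto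
    then have "B1.p w = B1.p (s y)"
      using proj_\<phi>[of w] proj_\<phi>[of "s y"] w(3) s[OF elim(1)] by simp
    then have "B1.fib_dist w (s y) < e"
      using thin[OF w(1)] s[OF elim(1)] by simp
    then show ?case
      using w s[OF elim(1)] by (intro bexI[of _ w]) auto
  qed
qed

section \<open>Selections glued by a partition of unity\<close>

lemma lift_if_section:
  assumes "\<And>y. y \<in> topspace B2.E \<Longrightarrow> f y \<in> topspace B1.E \<and> \<phi> (f y) = y"
  shows "lift f"
  unfolding lift_def
proof
  fix y assume "y \<in> topspace B2.E"
  then show "f y \<in> fiber \<xi>1 (B2.p y)"
    using assms[of y] proj_\<phi>[of "f y"] by (simp add: B1.mem_fiber_iff)
qed

text \<open>A selection step for convex sets \<open>C y\<close> of preimages of \<open>y\<close>.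
  Locally, arbitrary points of \<open>C y\<close> in a thin set form an \<open>e\<close>-continuous
  map; averaging these maps stays in \<open>C y\<close> by convexity and keeps the tolerance
  \<open>e\<close>. It is stated for general \<open>C\<close> because it is applied to full
  preimages and to preimages within a ball around a given section. The combinations are indexed by
  sets because the members of the refining cover serve as indices.\<close>

lemma approx_continuous_selection:
  fixes C :: "'e2 \<Rightarrow> 'e1 set"
  assumes para: "paracompact_space B2.E" and e: "0 \<le> e"
    and C: "\<And>x y. y \<in> topspace B2.E \<Longrightarrow> x \<in> C y \<Longrightarrow> x \<in> topspace B1.E \<and> \<phi> x = y"
    and convex: "\<And>y c x F :: 'e2 set set. y \<in> topspace B2.E \<Longrightarrow> finite F \<Longrightarrow> sum c F = 1 \<Longrightarrow>
        (\<And>i. i \<in> F \<Longrightarrow> 0 \<le> c i) \<Longrightarrow> (\<And>i. i \<in> F \<Longrightarrow> x i \<in> C y) \<Longrightarrow>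
        B1.fib_sum (B2.p y) (\<lambda>i. fib_scale \<xi>1 (of_real (c i)) (x i)) F \<in> C y"
    and near: "\<And>y0. y0 \<in> topspace B2.E \<Longrightarrow> \<exists>N U. openin B2.E N \<and> y0 \<in> N \<and> openin B1.E U \<and>
        (\<forall>a\<in>U. \<forall>b\<in>U. B1.p a = B1.p b \<longrightarrow> B1.fib_dist a b < e) \<and> (\<forall>y\<in>N. C y \<inter> U \<noteq> {})"
  obtains f where "\<And>y. y \<in> topspace B2.E \<Longrightarrow> f y \<in> C y"
    "\<And>y0. y0 \<in> topspace B2.E \<Longrightarrow> approx_continuous (\<lambda>_. e) f y0"
proof -
  let ?Y = "topspace B2.E"
  have "\<forall>y0\<in>?Y. \<exists>NU. openin B2.E (fst NU) \<and> y0 \<in> fst NU \<and> openin B1.E (snd NU) \<and>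
        (\<forall>a\<in>snd NU. \<forall>b\<in>snd NU. B1.p a = B1.p b \<longrightarrow> B1.fib_dist a b < e) \<and>
        (\<forall>y\<in>fst NU. C y \<inter> snd NU \<noteq> {})"
    using near by simp
  from bchoice[OF this] obtain NU where NU: "\<forall>y0\<in>?Y. openin B2.E (fst (NU y0)) \<and> y0 \<in> fst (NU y0)
        \<and> openin B1.E (snd (NU y0)) \<and>
        (\<forall>a\<in>snd (NU y0). \<forall>b\<in>snd (NU y0). B1.p a = B1.p b \<longrightarrow> B1.fib_dist a b < e) \<and>
        (\<forall>y\<in>fst (NU y0). C y \<inter> snd (NU y0) \<noteq> {})" ..
  define N where "N y = fst (NU y)" for y
  define U where "U y = snd (NU y)" for y
  have N: "openin B2.E (N y)" "y \<in> N y" if "y \<in> ?Y" for y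
    using NU that by (auto simp: N_def)
  have U: "openin B1.E (U y)" if "y \<in> ?Y" for y
    using NU that by (auto simp: U_def)
  have thin: "B1.fib_dist a b < e"
    if "y \<in> ?Y" "a \<in> U y" "b \<in> U y" "B1.p a = B1.p b" for y a b
    using NU that by (auto simp: U_def)
  have CU: "C y \<inter> U y0 \<noteq> {}" if "y0 \<in> ?Y" "y \<in> N y0" for y0 y
    using NU that by (auto simp: U_def N_def)
  have op: "openin B2.E M" if "M \<in> N ` ?Y" for M
    using that N by auto
  have cov: "?Y \<subseteq> \<Union>(N ` ?Y)"
    using N(2) by auto
  obtain \<V> and h :: "'e2 set \<Rightarrow> 'e2 \<Rightarrow> real"
    where \<V>: "locally_finite_in B2.E \<V>"
      "\<forall>V\<in>\<V>. openin B2.E V \<and> (\<exists>M\<in>N ` ?Y. B2.E closure_of V \<subseteq> M)"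
    and h: "\<forall>V\<in>\<V>. continuous_map B2.E euclideanreal (h V)"
      "\<forall>V\<in>\<V>. \<forall>x\<in>?Y. 0 \<le> h V x \<and> (x \<notin> V \<longrightarrow> h V x = 0)"
      "\<forall>x\<in>?Y. (\<Sum>V | V \<in> \<V> \<and> x \<in> V. h V x) = 1"
    by (rule paracompact_partition_of_unity[OF para op cov])
  have V_sub: "V \<subseteq> B2.E closure_of V" if "V \<in> \<V>" for V
    using \<V>(2) that by (intro closure_of_subset openin_subset) blast
  have "\<forall>V\<in>\<V>. \<exists>y. y \<in> ?Y \<and> B2.E closure_of V \<subseteq> N y"
    using \<V>(2) by auto
  from bchoice[OF this] obtain k where k: "\<forall>V\<in>\<V>. k V \<in> ?Y \<and> B2.E closure_of V \<subseteq> N (k V)" ..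
  define a where "a y = (SOME x. x \<in> topspace B1.E \<and> \<phi> x = y)" for y
  have a: "a y \<in> topspace B1.E \<and> \<phi> (a y) = y" if "y \<in> ?Y" for y
    unfolding a_def
  proof (rule someI_ex)
    show "\<exists>x. x \<in> topspace B1.E \<and> \<phi> x = y"
      using that surj_\<phi> by (metis imageE)
  qed
  \<comment> \<open>Off \<open>N (k V)\<close> any preimage is taken, which makes \<open>s V\<close>
    a section of \<phi> on the whole space; the weight \<open>h V\<close> vanishes there.\<close>
  define s where "s V y = (if y \<in> N (k V) then SOME x. x \<in> C y \<inter> U (k V) else a y)" for V y
  have s_in: "s V y \<in> C y \<inter> U (k V)" if "V \<in> \<V>" "y \<in> N (k V)" for V y
    using CU[of "k V" y] k that some_in_eq[of "C y \<inter> U (k V)"] by (simp add: s_def)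
  have s: "s V y \<in> topspace B1.E \<and> \<phi> (s V y) = y" if "V \<in> \<V>" "y \<in> ?Y" for V y
  proof (cases "y \<in> N (k V)")
    case True
    then show ?thesis
      using s_in[OF that(1)] C[OF that(2)] by blast
  next
    case False
    then show ?thesis
      using a[OF that(2)] by (simp add: s_def)
  qed
  \<comment> \<open>A weighted section is still a lift but in general no section of \<phi>; only the
    sum of all of them is one again. For this reason the rules for linear operations are formulated
    for lifts.\<close>
  define t where "t V y = fib_scale \<xi>1 (of_real (h V y)) (s V y)" for V y
  have lift_s: "lift (s V)" if "V \<in> \<V>" for V
    using s[OF that] by (rule lift_if_section)
  have lift_t: "lift (t V)" if "V \<in> \<V>" for V
    unfolding t_def using lift_s[OF that] by (rule lift_scale)
  have t_zero: "t V y = fib_zero \<xi>1 (B2.p y)" if "V \<in> \<V>" "y \<in> ?Y" "y \<notin> V" for V y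
    using bspec[OF bspec[OF h(2) that(1)] that(2)] that(3) B1.fib_scale_zero_left[OF liftD[OF lift_s[OF that(1)] that(2)]]
    by (simp add: t_def)
  have t_cont: "approx_continuous (\<lambda>y. h V y * e) (t V) y0" if V: "V \<in> \<V>" and y0: "y0 \<in> ?Y" for V y0
  proof (cases "y0 \<in> N (k V)")
    case True
    have kV: "k V \<in> ?Y"
      using k V by blast
    have "approx_continuous (\<lambda>_. e) (s V) y0"
    proof (rule approx_continuous_thin_lift[OF y0 _ N(1)[OF kV] True U[OF kV] thin[OF kV]])
      show "s V y0 \<in> U (k V)"
        using s_in[OF V True] by blast
      fix y assume y: "y \<in> N (k V)"
      then have "y \<in> ?Y"
        using N(1)[OF kV] openin_subset by blast
      then show "s V y \<in> U (k V) \<and> \<phi> (s V y) = y"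
        using s_in[OF V y] s[OF V] by blast
    qed
    moreover have "(h V \<longlongrightarrow> h V y0) (nhdsin B2.E y0)"
    proof (rule topological_tendstoI)
      fix S assume "open S" "h V y0 \<in> S"
      then have "openin B2.E {y \<in> ?Y. h V y \<in> S}"
        using openin_continuous_map_preimage[OF bspec[OF h(1) V]] by simp
      then have "\<forall>\<^sub>F y in nhdsin B2.E y0. y \<in> {y \<in> ?Y. h V y \<in> S}"
        using y0 \<open>h V y0 \<in> S\<close> by (intro eventually_nhdsin_openin) auto
      then show "\<forall>\<^sub>F y in nhdsin B2.E y0. h V y \<in> S"
        by (rule eventually_mono) simp
    qed
    ultimately have "approx_continuous (\<lambda>y. \<bar>h V y\<bar> * e) (t V) y0"
      unfolding t_def using lift_s[OF V] y0 by (intro approx_continuous_scale)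
    then show ?thesis
    proof (rule approx_continuous_cong[OF _ _ y0])
      show "\<forall>\<^sub>F y in nhdsin B2.E y0. t V y = t V y \<and> \<bar>h V y\<bar> * e \<le> h V y * e"
        using eventually_nhdsin_topspace by (rule eventually_mono) (use h(2) V in simp)
    qed
  next
    case False
    show ?thesis
    proof (rule approx_continuous_cong[OF approx_continuous_zero[OF y0] _ y0])
      \<comment> \<open>As the closure of \<open>V\<close> lies in \<open>N (k V)\<close>, its
        complement is a neighbourhood of \<open>y0\<close>, and there \<open>t V\<close> is the zero
        section. Containment of \<open>V\<close> alone would not provide such a
        neighbourhood.\<close>
      have "openin B2.E (?Y - B2.E closure_of V)"
        by (simp add: openin_diff)
      moreover have "y0 \<in> ?Y - B2.E closure_of V"
        using False k V y0 by blast
      ultimately have "\<forall>\<^sub>F y in nhdsin B2.E y0. y \<in> ?Y - B2.E closure_of V"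
        by (rule eventually_nhdsin_openin)
      then show "\<forall>\<^sub>F y in nhdsin B2.E y0. fib_zero \<xi>1 (B2.p y) = t V y \<and> 0 \<le> h V y * e"
      proof eventually_elim
        case (elim y)
        then have "y \<in> ?Y" "y \<notin> V"
          using V_sub[OF V] by auto
        then show ?case
          using t_zero[OF V] h(2) V e by simp
      qed
    qed
  qed
  define f where "f y = B1.fib_sum (B2.p y) (\<lambda>V. t V y) {V \<in> \<V>. y \<in> V}" for y
  show ?thesis
  proof (rule that)
    fix y assume y: "y \<in> ?Y"
    show "f y \<in> C y"
      unfolding f_def t_def
    proof (rule convex[OF y locally_finite_in_at[OF \<V>(1) y] bspec[OF h(3) y]])
      fix V assume V: "V \<in> {V \<in> \<V>. y \<in> V}"
      then show "0 \<le> h V y"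
        using h(2) y by blast
      have "y \<in> B2.E closure_of V"
        using V V_sub by auto
      then have "y \<in> N (k V)"
        using V k by auto
      then show "s V y \<in> C y"
        using s_in V by blast
    qed
  next
    fix y0 assume y0: "y0 \<in> ?Y"
    obtain M where M: "openin B2.E M" "y0 \<in> M" "finite {V \<in> \<V>. V \<inter> M \<noteq> {}}"
      using locally_finite_in_nhd[OF \<V>(1) y0] by metis
    \<comment> \<open>The index set in \<open>f\<close> varies with \<open>y\<close>; on
      \<open>M\<close> it is enlarged to this fixed finite set by adding zero vectors, so that the
      rule for finite sums applies.\<close>
    let ?F = "{V \<in> \<V>. V \<inter> M \<noteq> {}}"
    have "approx_continuous (\<lambda>y. \<Sum>V\<in>?F. h V y * e) (\<lambda>y. B1.fib_sum (B2.p y) (\<lambda>V. t V y) ?F) y0"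
      using lift_t t_cont[OF _ y0] by (intro approx_continuous_sum y0 M(3)) auto
    then show "approx_continuous (\<lambda>_. e) f y0"
    proof (rule approx_continuous_cong[OF _ _ y0])
      show "\<forall>\<^sub>F y in nhdsin B2.E y0. B1.fib_sum (B2.p y) (\<lambda>V. t V y) ?F = f y \<and> (\<Sum>V\<in>?F. h V y * e) \<le> e"
        using eventually_nhdsin_openin[OF M(1,2)]
      proof eventually_elim
        case (elim y)
        then have y: "y \<in> ?Y"
          using openin_subset[OF M(1)] by blast
        have sub: "{V \<in> \<V>. y \<in> V} \<subseteq> ?F"
          using elim by blast
        have base: "B2.p y \<in> topspace (base_space \<xi>1)"
          using B2.fiber_base[OF B2.mem_fiber_self[OF y]] by (simp add: base_eq)
        have "f y = B1.fib_sum (B2.p y) (\<lambda>V. t V y) ?F"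
          unfolding f_def
        proof (rule B1.fib_sum_mono_neutral[OF base M(3) sub])
          show "t V y \<in> fiber \<xi>1 (B2.p y)" if "V \<in> ?F" for V
            using that liftD[OF lift_t y] by simp
          show "t V y = fib_zero \<xi>1 (B2.p y)" if "V \<in> ?F - {V \<in> \<V>. y \<in> V}" for V
            using that t_zero y by simp
        qed
        \<comment> \<open>The weights over the enlarged set still add up to 1, so the weighted
          tolerances add up to \<open>e\<close>.\<close>
        moreover have "(\<Sum>V\<in>?F. h V y) = (\<Sum>V | V \<in> \<V> \<and> y \<in> V. h V y)"
          using sub h(2) y by (intro sum.mono_neutral_right M(3)) auto
        then have "(\<Sum>V\<in>?F. h V y * e) = e"
          using bspec[OF h(3) y] by (simp flip: sum_distrib_right)
        ultimately show ?case
          by simp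
      qed
    qed
  qed
qed

text \<open>Selection from the full preimages. Near \<open>y0\<close> take a thin neighbourhood
  \<open>U\<close> of any preimage of \<open>y0\<close>; its image under the open map \<phi>
  consists of points with a preimage in \<open>U\<close>.\<close>

lemma approx_continuous_section_exists:
  assumes para: "paracompact_space B2.E" and e: "0 < e"
  obtains f where "\<And>y. y \<in> topspace B2.E \<Longrightarrow> f y \<in> topspace B1.E \<and> \<phi> (f y) = y"
    "\<And>y0. y0 \<in> topspace B2.E \<Longrightarrow> approx_continuous (\<lambda>_. e) f y0"
proof -
  define C where "C y = {x \<in> topspace B1.E. \<phi> x = y}" for y
  have "\<exists>f. (\<forall>y\<in>topspace B2.E. f y \<in> C y) \<and> (\<forall>y0\<in>topspace B2.E. approx_continuous (\<lambda>_. e) f y0)"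
  proof (rule approx_continuous_selection[where C = C and e = e])
    show "paracompact_space B2.E" "0 \<le> e"
      using para e by auto
    show "x \<in> topspace B1.E \<and> \<phi> x = y" if "x \<in> C y" for x y
      using that by (simp add: C_def)
  next
    fix y :: 'e2 and c :: "'e2 set \<Rightarrow> real" and x F
    assume y: "y \<in> topspace B2.E" and F: "finite F" "sum c F = 1"
      and x: "\<And>i. i \<in> F \<Longrightarrow> x i \<in> C y"
    have x': "x i \<in> topspace B1.E \<and> \<phi> (x i) = y" if "i \<in> F" for i
      using x[OF that] by (simp add: C_def)
    have "x i \<in> fiber \<xi>1 (B2.p y)" if "i \<in> F" for i
      using x'[OF that] proj_\<phi>[of "x i"] by (simp add: B1.mem_fiber_iff)
    then have "B1.fib_sum (B2.p y) (\<lambda>i. fib_scale \<xi>1 (of_real (c i)) (x i)) F \<in> fiber \<xi>1 (B2.p y)"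
      using B2.fiber_base[OF B2.mem_fiber_self[OF y]] base_eq
      by (intro B1.fib_sum_closed B1.fib_scale_closed B1.of_real_scalar) auto
    then show "B1.fib_sum (B2.p y) (\<lambda>i. fib_scale \<xi>1 (of_real (c i)) (x i)) F \<in> C y"
      using \<phi>_convex_combination[OF y F x'] by (simp add: C_def B1.mem_fiber_iff)
  next
    fix y0 assume y0: "y0 \<in> topspace B2.E"
    then have "y0 \<in> \<phi> ` topspace B1.E"
      using surj_\<phi> by simp
    then obtain x0 where x0: "x0 \<in> topspace B1.E" "\<phi> x0 = y0"
      by blast
    obtain U where U: "openin B1.E U" "x0 \<in> U"
      "\<And>a b. a \<in> U \<Longrightarrow> b \<in> U \<Longrightarrow> B1.p a = B1.p b \<Longrightarrow> B1.fib_dist a b < e"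
      using B1.thin_nhd[OF x0(1) e] by metis
    have "C y \<inter> U \<noteq> {}" if "y \<in> \<phi> ` U" for y
      using that openin_subset[OF U(1)] by (auto simp: C_def)
    then show "\<exists>N U. openin B2.E N \<and> y0 \<in> N \<and> openin B1.E U \<and>
        (\<forall>a\<in>U. \<forall>b\<in>U. B1.p a = B1.p b \<longrightarrow> B1.fib_dist a b < e) \<and> (\<forall>y\<in>N. C y \<inter> U \<noteq> {})"
      using U x0(2) open_\<phi> by (intro exI[of _ "\<phi> ` U"] exI[of _ U]) (auto simp: open_map_def)
  next
    fix f assume "\<And>y. y \<in> topspace B2.E \<Longrightarrow> f y \<in> C y"
      "\<And>y0. y0 \<in> topspace B2.E \<Longrightarrow> approx_continuous (\<lambda>_. e) f y0"
    then show "\<exists>f. (\<forall>y\<in>topspace B2.E. f y \<in> C y) \<and> (\<forall>y0\<in>topspace B2.E. approx_continuous (\<lambda>_. e) f y0)"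
      by blast
  qed
  then obtain f where "\<forall>y\<in>topspace B2.E. f y \<in> C y"
      "\<forall>y0\<in>topspace B2.E. approx_continuous (\<lambda>_. e) f y0"
    by blast
  then show ?thesis
    by (intro that[of f]) (auto simp: C_def)
qed

text \<open>Selection from the preimages within \<open>d\<close> of \<open>f y\<close>, a convex
  set. The tolerance drops from \<open>d\<close> to any positive \<open>e\<close>, at the price of
  moving the section by at most \<open>d\<close>.\<close>

lemma approx_continuous_section_refine:
  assumes para: "paracompact_space B2.E" and e: "0 < e"
    and f: "\<And>y. y \<in> topspace B2.E \<Longrightarrow> f y \<in> topspace B1.E \<and> \<phi> (f y) = y"
    and cont: "\<And>y0. y0 \<in> topspace B2.E \<Longrightarrow> approx_continuous (\<lambda>_. d) f y0"
  obtains g where "\<And>y. y \<in> topspace B2.E \<Longrightarrow> g y \<in> topspace B1.E \<and> \<phi> (g y) = y"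
    "\<And>y. y \<in> topspace B2.E \<Longrightarrow> B1.fib_dist (g y) (f y) \<le> d"
    "\<And>y0. y0 \<in> topspace B2.E \<Longrightarrow> approx_continuous (\<lambda>_. e) g y0"
proof -
  define C where "C y = {x \<in> topspace B1.E. \<phi> x = y \<and> B1.fib_dist x (f y) \<le> d}" for y
  have lift_f: "lift f"
    using f by (rule lift_if_section)
  have "\<exists>g. (\<forall>y\<in>topspace B2.E. g y \<in> C y) \<and> (\<forall>y0\<in>topspace B2.E. approx_continuous (\<lambda>_. e) g y0)"
  proof (rule approx_continuous_selection[where C = C and e = e])
    show "paracompact_space B2.E" "0 \<le> e"
      using para e by auto
    show "x \<in> topspace B1.E \<and> \<phi> x = y" if "x \<in> C y" for x y
      using that by (simp add: C_def)
  next
    fix y :: 'e2 and c :: "'e2 set \<Rightarrow> real" and x F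
    assume y: "y \<in> topspace B2.E" and F: "finite F" "sum c F = 1"
      and c: "\<And>i. i \<in> F \<Longrightarrow> 0 \<le> c i" and x: "\<And>i. i \<in> F \<Longrightarrow> x i \<in> C y"
    have x': "x i \<in> topspace B1.E \<and> \<phi> (x i) = y" "B1.fib_dist (x i) (f y) \<le> d" if "i \<in> F" for i
      using x[OF that] by (simp_all add: C_def)
    have xf: "x i \<in> fiber \<xi>1 (B2.p y)" if "i \<in> F" for i
      using x'(1)[OF that] proj_\<phi>[of "x i"] by (simp add: B1.mem_fiber_iff)
    then have "B1.fib_sum (B2.p y) (\<lambda>i. fib_scale \<xi>1 (of_real (c i)) (x i)) F \<in> fiber \<xi>1 (B2.p y)"
      using B2.fiber_base[OF B2.mem_fiber_self[OF y]] base_eq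
      by (intro B1.fib_sum_closed B1.fib_scale_closed B1.of_real_scalar) auto
    moreover have "B1.fib_dist (B1.fib_sum (B2.p y) (\<lambda>i. fib_scale \<xi>1 (of_real (c i)) (x i)) F) (f y) \<le> d"
      by (rule B1.fib_dist_convex_combination[OF liftD[OF lift_f y] F xf x'(2) c])
    ultimately show "B1.fib_sum (B2.p y) (\<lambda>i. fib_scale \<xi>1 (of_real (c i)) (x i)) F \<in> C y"
      using \<phi>_convex_combination[OF y F x'(1)] by (simp add: C_def B1.mem_fiber_iff)
  next
    fix y0 assume y0: "y0 \<in> topspace B2.E"
    then have fy0: "f y0 \<in> topspace B1.E"
      using f by blast
    obtain U where U: "openin B1.E U" "f y0 \<in> U"
      "\<And>a b. a \<in> U \<Longrightarrow> b \<in> U \<Longrightarrow> B1.p a = B1.p b \<Longrightarrow> B1.fib_dist a b < e"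
      using B1.thin_nhd[OF fy0 e] by metis
    \<comment> \<open>The witnesses for approximate continuity of \<open>f\<close>, applied to a
      thin neighbourhood of \<open>f y0\<close>, are the points of \<open>C y\<close> in
      \<open>U\<close> that the selection requires.\<close>
    from approx_continuousD[OF cont[OF y0] U(1,2)] y0
    obtain N where N: "openin B2.E N" "y0 \<in> N"
      "\<forall>y\<in>N. \<exists>w\<in>U. \<phi> w = \<phi> (f y) \<and> B1.fib_dist w (f y) \<le> d"
      unfolding eventually_nhdsin by blast
    have "C y \<inter> U \<noteq> {}" if y: "y \<in> N" for y
    proof -
      obtain w where w: "w \<in> U" "\<phi> w = \<phi> (f y)" "B1.fib_dist w (f y) \<le> d"
        using N(3) y by blast
      have "\<phi> (f y) = y"
        using f[of y] y openin_subset[OF N(1)] by blast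
      then have "w \<in> C y"
        using w openin_subset[OF U(1)] by (auto simp: C_def)
      then show ?thesis
        using w(1) by blast
    qed
    then show "\<exists>N U. openin B2.E N \<and> y0 \<in> N \<and> openin B1.E U \<and>
        (\<forall>a\<in>U. \<forall>b\<in>U. B1.p a = B1.p b \<longrightarrow> B1.fib_dist a b < e) \<and> (\<forall>y\<in>N. C y \<inter> U \<noteq> {})"
      using U N(1,2) by (intro exI[of _ N] exI[of _ U]) simp
  next
    fix g assume "\<And>y. y \<in> topspace B2.E \<Longrightarrow> g y \<in> C y"
      "\<And>y0. y0 \<in> topspace B2.E \<Longrightarrow> approx_continuous (\<lambda>_. e) g y0"
    then show "\<exists>g. (\<forall>y\<in>topspace B2.E. g y \<in> C y) \<and> (\<forall>y0\<in>topspace B2.E. approx_continuous (\<lambda>_. e) g y0)"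
      by blast
  qed
  then obtain g where "\<forall>y\<in>topspace B2.E. g y \<in> C y"
      "\<forall>y0\<in>topspace B2.E. approx_continuous (\<lambda>_. e) g y0"
    by blast
  then show ?thesis
    by (intro that[of g]) (auto simp: C_def)
qed

section \<open>Limits of approximate sections\<close>

lemma section_limit:
  assumes Hausdorff: "Hausdorff_space B2.E" and y: "y \<in> topspace B2.E"
    and f: "\<And>n. f n \<in> topspace B1.E \<and> \<phi> (f n) = y"
    and l: "l \<in> fiber \<xi>1 (B2.p y)" "(\<lambda>n. B1.fib_dist (f n) l) \<longlonglongrightarrow> 0"
  shows "\<phi> l = y"
proof -
  let ?t = "B2.p y"
  note t2 = B2.fiber_base[OF B2.mem_fiber_self[OF y]]
  have t1: "?t \<in> topspace (base_space \<xi>1)"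
    using t2 by (simp add: base_eq)
  have m1: "- 1 \<in> K"
    using B1.of_real_scalar[of "- 1"] by simp
  \<comment> \<open>This fixed vector is the image of the difference of \<open>f n\<close> and
    \<open>l\<close> for every \<open>n\<close>. The differences tend to the origin, so by
    continuity of \<phi> the vector lies in every neighbourhood of the origin of its fibre, and the
    Hausdorff property makes it zero.\<close>
  let ?z = "fib_add \<xi>2 y (fib_scale \<xi>2 (- 1) (\<phi> l))"
  have fn: "f n \<in> fiber \<xi>1 ?t" for n
    using f[of n] proj_\<phi>[of "f n"] by (simp add: B1.mem_fiber_iff)
  have z: "\<phi> (fib_add \<xi>1 (f n) (fib_scale \<xi>1 (- 1) l)) = ?z" for n
    using \<phi>_add[OF fn B1.fib_scale_closed[OF m1 l(1)]] \<phi>_scale[OF m1 l(1)] f by simp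
  have "?z \<in> W" if W: "openin B2.E W" "fib_zero \<xi>2 ?t \<in> W" for W
  proof -
    let ?W = "{x \<in> topspace B1.E. \<phi> x \<in> W}"
    have op: "openin B1.E ?W"
      using openin_continuous_map_preimage[OF continuous_\<phi> W(1)] .
    have zero: "fib_zero \<xi>1 ?t \<in> ?W"
      using B1.fib_zero_closed[OF t1] \<phi>_zero[OF t2] W(2) by (simp add: B1.mem_fiber_iff)
    from B1.zero_nhd[OF t1 op zero]
    obtain V e where V: "openin (base_space \<xi>1) V" "?t \<in> V" "0 < e"
      "\<And>x. x \<in> topspace B1.E \<Longrightarrow> B1.p x \<in> V \<Longrightarrow> fib_norm \<xi>1 x < e \<Longrightarrow> x \<in> ?W"
      by blast
    have "\<forall>\<^sub>F n in sequentially. B1.fib_dist (f n) l < e"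
      using order_tendstoD(2)[OF l(2) V(3)] .
    then obtain n where n: "B1.fib_dist (f n) l < e"
      unfolding eventually_sequentially by blast
    have "fib_add \<xi>1 (f n) (fib_scale \<xi>1 (- 1) l) \<in> ?W"
      using B1.fib_diff_closed[OF fn l(1)] V(2) n
      by (intro V(4)) (simp_all add: B1.mem_fiber_iff B1.fib_dist_def)
    then show ?thesis
      using z[of n] by simp
  qed
  note z_near = this
  have "?z \<in> topspace B2.E" "fib_zero \<xi>2 ?t \<in> topspace B2.E"
    using B2.fib_diff_closed[OF B2.mem_fiber_self[OF y] \<phi>_fiber[OF l(1)]] B2.fib_zero_closed[OF t2]
    by (simp_all add: B2.mem_fiber_iff)
  note z_in = this
  have "?z = fib_zero \<xi>2 ?t"
  proof (rule ccontr)
    assume "?z \<noteq> fib_zero \<xi>2 ?t"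
    then have "\<exists>U V. openin B2.E U \<and> openin B2.E V \<and> ?z \<in> U \<and> fib_zero \<xi>2 ?t \<in> V \<and> disjnt U V"
      using Hausdorff z_in by (simp add: Hausdorff_space_def)
    then obtain U V where "openin B2.E V" "?z \<in> U" "fib_zero \<xi>2 ?t \<in> V" "disjnt U V"
      by (elim exE conjE)
    then show False
      using z_near[of V] by (simp add: disjnt_iff)
  qed
  then have "y = fib_add \<xi>2 (\<phi> l) (fib_zero \<xi>2 ?t)"
    using B2.fib_add_diff[OF B2.mem_fiber_self[OF y] \<phi>_fiber[OF l(1)]] by simp
  then show ?thesis
    using B2.fib_add_zero[OF \<phi>_fiber[OF l(1)]] by simp
qed

text \<open>An argument with three errors below \<open>e / 3\<close>: from \<open>g y\<close> to
  \<open>f n y\<close> by uniform approximation, from \<open>f n y\<close> to a witness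
  \<open>v\<close> by approximate continuity, and from \<open>v\<close> to a point \<open>w\<close>
  of \<open>A\<close> by the choice of the thickening. By \<open>uniform_nhd\<close> the total bound
  \<open>e\<close> forces \<open>g y\<close> into \<open>W\<close>.\<close>

lemma continuous_map_uniform_limit:
  assumes g: "lift g" and f: "\<And>n. lift (f n)"
    and cont: "\<And>n y0. y0 \<in> topspace B2.E \<Longrightarrow> approx_continuous (\<lambda>_. b n) (f n) y0"
    and bound: "\<And>n y. y \<in> topspace B2.E \<Longrightarrow> B1.fib_dist (f n y) (g y) \<le> b n"
    and b: "b \<longlonglongrightarrow> 0"
  shows "continuous_map B2.E B1.E g"
  unfolding continuous_map_def
proof (intro conjI allI impI)
  show "g \<in> topspace B2.E \<rightarrow> topspace B1.E"
    using g by (auto simp: lift_def B1.mem_fiber_iff)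
  fix W assume W: "openin B1.E W"
  have "\<exists>T. openin B2.E T \<and> y0 \<in> T \<and> T \<subseteq> {y \<in> topspace B2.E. g y \<in> W}"
    if y0: "y0 \<in> topspace B2.E" "g y0 \<in> W" for y0
  proof -
    obtain A e where A: "openin B1.E A" "g y0 \<in> A" "0 < e"
      "\<And>a z. a \<in> A \<Longrightarrow> z \<in> topspace B1.E \<Longrightarrow> B1.p z = B1.p a \<Longrightarrow> B1.fib_dist z a < e \<Longrightarrow> z \<in> W"
      using B1.uniform_nhd[OF W y0(2)] by metis
    have "\<forall>\<^sub>F n in sequentially. b n < e / 3"
      using order_tendstoD(2)[OF b, of "e / 3"] A(3) by simp
    then obtain n where n: "b n < e / 3"
      unfolding eventually_sequentially by blast
    \<comment> \<open>The point \<open>f n y0\<close> need not lie in \<open>A\<close>; it is only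
      close to \<open>g y0\<close>. Approximate continuity is therefore applied to this open
      thickening of \<open>A\<close>.\<close>
    let ?A = "{a \<in> topspace B1.E. \<exists>w\<in>A. B1.p w = B1.p a \<and> B1.fib_dist a w < e / 3}"
    have opA: "openin B1.E ?A"
      by (rule B1.openin_thickening[OF A(1)])
    have "f n y0 \<in> ?A"
      using liftD[OF f y0(1), of n] liftD[OF g y0(1)] bound[OF y0(1), of n] n A(2)
      by (auto simp: B1.mem_fiber_iff intro!: bexI[of _ "g y0"])
    from approx_continuousD[OF cont[OF y0(1)] opA this] y0(1)
    obtain T where T: "openin B2.E T" "y0 \<in> T"
      "\<forall>y\<in>T. \<exists>w\<in>?A. \<phi> w = \<phi> (f n y) \<and> B1.fib_dist w (f n y) \<le> b n"
      unfolding eventually_nhdsin by blast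
    have "g y \<in> W" if y: "y \<in> T" for y
    proof -
      have yY: "y \<in> topspace B2.E"
        using y openin_subset[OF T(1)] by blast
      obtain v where v: "v \<in> ?A" "\<phi> v = \<phi> (f n y)" "B1.fib_dist v (f n y) \<le> b n"
        using T(3) y by blast
      obtain w where w: "w \<in> A" "B1.p w = B1.p v" "B1.fib_dist v w < e / 3"
        using v(1) by blast
      have vf: "v \<in> fiber \<xi>1 (B2.p y)"
        by (rule same_fiber[OF opA v(1) f yY v(2)])
      have wf: "w \<in> fiber \<xi>1 (B2.p y)"
        using vf w(1,2) openin_subset[OF A(1)] by (auto simp: B1.mem_fiber_iff)
      note ff = liftD[OF f yY, of n] and gf = liftD[OF g yY]
      have "B1.fib_dist (g y) w \<le> B1.fib_dist (g y) (f n y) + B1.fib_dist (f n y) w"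
        by (rule B1.fib_dist_triangle[OF gf ff wf])
      moreover have "B1.fib_dist (f n y) w \<le> B1.fib_dist (f n y) v + B1.fib_dist v w"
        by (rule B1.fib_dist_triangle[OF ff vf wf])
      ultimately have "B1.fib_dist (g y) w < e"
        using bound[OF yY, of n] v(3) w(3) n B1.fib_dist_commute[OF gf ff]
          B1.fib_dist_commute[OF ff vf] by linarith
      then show ?thesis
        using gf wf w(1) by (intro A(4)[of w]) (auto simp: B1.mem_fiber_iff)
    qed
    then show ?thesis
      using T(1,2) openin_subset[OF T(1)] by (intro exI[of _ T]) auto
  qed
  then show "openin B2.E {y \<in> topspace B2.E. g y \<in> W}"
    by (subst openin_subopen) simp
qed

theorem continuous_section_exists:
  assumes para: "paracompact_space B2.E"
  shows "\<exists>\<psi>. continuous_map B2.E B1.E \<psi> \<and> (\<forall>y\<in>topspace B2.E. \<phi> (\<psi> y) = y)"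
proof -
  let ?Y = "topspace B2.E"
  \<comment> \<open>Each stage may move the section by the tolerance reached so far,
    \<open>(1 / 2) ^ n\<close>, while the tolerance is halved; the movements are therefore
    summable.\<close>
  define P where "P n f \<longleftrightarrow> (\<forall>y\<in>?Y. f y \<in> topspace B1.E \<and> \<phi> (f y) = y) \<and>
      (\<forall>y\<in>?Y. approx_continuous (\<lambda>_. (1 / 2) ^ n) f y)" for n :: nat and f
  define Q where "Q n f g \<longleftrightarrow> (\<forall>y\<in>?Y. B1.fib_dist (g y) (f y) \<le> (1 / 2) ^ n)" for n :: nat and f g
  have "\<exists>f. P 0 f"
  proof (rule approx_continuous_section_exists[OF para zero_less_one])
    fix f assume "\<And>y. y \<in> ?Y \<Longrightarrow> f y \<in> topspace B1.E \<and> \<phi> (f y) = y"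
      "\<And>y0. y0 \<in> ?Y \<Longrightarrow> approx_continuous (\<lambda>_. 1) f y0"
    then show ?thesis
      unfolding P_def by (intro exI[of _ f]) simp
  qed
  moreover have "\<exists>g. P (Suc n) g \<and> Q n f g" if Pf: "P n f" for n f
  proof -
    have f: "f y \<in> topspace B1.E \<and> \<phi> (f y) = y" "approx_continuous (\<lambda>_. (1 / 2) ^ n) f y"
      if "y \<in> ?Y" for y
      using Pf that by (auto simp: P_def)
    have "(0::real) < (1 / 2) ^ Suc n"
      by simp
    from approx_continuous_section_refine[OF para this f]
    obtain g where "\<And>y. y \<in> ?Y \<Longrightarrow> g y \<in> topspace B1.E \<and> \<phi> (g y) = y"
      "\<And>y. y \<in> ?Y \<Longrightarrow> B1.fib_dist (g y) (f y) \<le> (1 / 2) ^ n"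
      "\<And>y. y \<in> ?Y \<Longrightarrow> approx_continuous (\<lambda>_. (1 / 2) ^ Suc n) g y"
      by metis
    then show ?thesis
      unfolding P_def Q_def by (intro exI[of _ g]) simp
  qed
  ultimately have "\<exists>f. \<forall>n. P n (f n) \<and> Q n (f n) (f (Suc n))"
    by (rule dependent_nat_choice)
  then obtain f where f: "\<And>n. P n (f n)" "\<And>n. Q n (f n) (f (Suc n))"
    by blast
  have sec: "f n y \<in> topspace B1.E \<and> \<phi> (f n y) = y" if "y \<in> ?Y" for n y
    using f(1)[of n] that by (simp add: P_def)
  have lift_f: "lift (f n)" for n
    using sec by (rule lift_if_section)
  \<comment> \<open>The tail from \<open>n\<close> on of the geometric series of movements.\<close>
  define b where "b n = 2 * (1 / 2 :: real) ^ n" for n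
  have "b \<longlonglongrightarrow> 2 * 0"
    unfolding b_def by (intro tendsto_mult tendsto_const LIMSEQ_power_zero) simp
  then have b: "b \<longlonglongrightarrow> 0"
    by simp
  \<comment> \<open>The bound is the exact partial sum of the movements from stage \<open>n\<close>
    to stage \<open>n + k\<close>; the cruder bound \<open>b n\<close> would not be preserved by the
    induction.\<close>
  have telescope: "B1.fib_dist (f (n + k) y) (f n y) \<le> b n - b (n + k)" if y: "y \<in> ?Y" for n k y
  proof (induction k)
    case 0
    show ?case
      using B1.fib_dist_self[OF liftD[OF lift_f y]] by simp
  next
    case (Suc k)
    have "B1.fib_dist (f (Suc (n + k)) y) (f (n + k) y) \<le> (1 / 2) ^ (n + k)"
      using f(2)[of "n + k"] y by (simp add: Q_def)
    with Suc.IH B1.fib_dist_triangle[OF liftD[OF lift_f[of "n + Suc k"] y]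
        liftD[OF lift_f[of "n + k"] y] liftD[OF lift_f[of n] y]]
    show ?case
      by (simp add: b_def)
  qed
  have bound: "B1.fib_dist (f (n + k) y) (f n y) \<le> b n" if "y \<in> ?Y" for n k y
    using telescope[OF that, of n k] by (rule order_trans) (simp add: b_def)
  have "\<exists>l. l \<in> fiber \<xi>1 (B2.p y) \<and> (\<forall>n. B1.fib_dist (f n y) l \<le> b n) \<and>
      (\<lambda>n. B1.fib_dist (f n y) l) \<longlonglongrightarrow> 0" if y: "y \<in> ?Y" for y
  proof -
    have "B2.p y \<in> topspace (base_space \<xi>1)"
      using B2.fiber_base[OF B2.mem_fiber_self[OF y]] by (simp add: base_eq)
    from B1.fib_dist_complete[OF this liftD[OF lift_f y] bound[OF y] b]
    obtain l where "l \<in> fiber \<xi>1 (B2.p y)" "\<And>n. B1.fib_dist (f n y) l \<le> b n"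
      "(\<lambda>n. B1.fib_dist (f n y) l) \<longlonglongrightarrow> 0"
      by metis
    then show ?thesis
      by (intro exI[of _ l]) simp
  qed
  then have "\<forall>y\<in>?Y. \<exists>l. l \<in> fiber \<xi>1 (B2.p y) \<and> (\<forall>n. B1.fib_dist (f n y) l \<le> b n) \<and>
      (\<lambda>n. B1.fib_dist (f n y) l) \<longlonglongrightarrow> 0"
    by blast
  from bchoice[OF this] obtain g where g: "\<forall>y\<in>?Y. g y \<in> fiber \<xi>1 (B2.p y) \<and>
      (\<forall>n. B1.fib_dist (f n y) (g y) \<le> b n) \<and> (\<lambda>n. B1.fib_dist (f n y) (g y)) \<longlonglongrightarrow> 0" ..
  have "continuous_map B2.E B1.E g"
  proof (rule continuous_map_uniform_limit[OF _ lift_f _ _ b])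
    show "lift g"
      using g by (simp add: lift_def)
    show "B1.fib_dist (f n y) (g y) \<le> b n" if "y \<in> ?Y" for n y
      using g that by blast
    \<comment> \<open>The tolerance \<open>(1 / 2) ^ n\<close> is relaxed to \<open>b n\<close>, so
      that one null sequence bounds both the discontinuity of \<open>f n\<close> and its distance to
      the limit.\<close>
    show "approx_continuous (\<lambda>_. b n) (f n) y0" if y0: "y0 \<in> ?Y" for n y0
    proof (rule approx_continuous_cong[OF _ _ y0])
      show "approx_continuous (\<lambda>_. (1 / 2) ^ n) (f n) y0"
        using f(1)[of n] y0 by (simp add: P_def)
    qed (simp add: b_def)
  qed
  moreover have "\<phi> (g y) = y" if y: "y \<in> ?Y" for y
  proof (rule section_limit[where f = "\<lambda>n. f n y", OF _ y sec[OF y]])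
    show "Hausdorff_space B2.E"
      using para by (simp add: paracompact_space_def)
  qed (use g y in blast)+
  ultimately show ?thesis
    by blast
qed

end

theorem proposition3p9:
  fixes K :: "complex set"
    and \<xi>1 :: "('e1, 't) bundle_data" and \<xi>2 :: "('e2, 't) bundle_data"
    and \<phi> :: "'e1 \<Rightarrow> 'e2"
  assumes "banach_bundle K \<xi>1"
    and "banach_bundle K \<xi>2"
    and "banach_bundle_map K \<xi>1 \<xi>2 \<phi>"
    and "open_map (bundle_space \<xi>1) (bundle_space \<xi>2) \<phi>"
    and "\<phi> ` topspace (bundle_space \<xi>1) = topspace (bundle_space \<xi>2)"
    and "paracompact_space (bundle_space \<xi>2)"
  shows "\<exists>\<psi>. continuous_map (bundle_space \<xi>2) (bundle_space \<xi>1) \<psi> \<and>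
             (\<forall>y\<in>topspace (bundle_space \<xi>2). \<phi> (\<psi> y) = y)"
proof -
  interpret open_bundle_map K \<xi>1 \<xi>2 \<phi>
    using assms by (simp add: open_bundle_map_def open_bundle_map_axioms_def)
  show ?thesis
    using assms(6) by (rule continuous_section_exists)
qed

end
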